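(* Let $f$ be a holomorphic cusp form of integer weight $k \geq 2$ on $\mathrm{SL}_2(\mathbb{Z})$ with Fourier expansion $f(z) = \sum_{n \geq 1} a(n) e^{2\pi i n z}$, and for $n \ge 1$ let $S_f(n) = \sum_{1 \le m \leq n} a(m)$. Then, for all sufficiently large $X$, \[ \frac{1}{X^{\frac{2}{3}} (\log X)^{\frac{1}{6}}} \sum_{\lvert n - X \rvert < X^{\frac{2}{3}} (\log X)^{\frac{1}{6}}} \lvert S_f(n) \rvert^2 \ll X^{k-1 + \frac{1}{2}}, \] where the sum is over positive integers $n$ and the implied constant depends only on $f$. *)

theory Defs
  imports "HOL-Complex_Analysis.Complex_Analysis" "HOL-Library.Landau_Symbols"
begin

definition upper_half_plane :: "complex set" where
  "upper_half_plane = {z. 0 < Im z}"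

text \<open>Weak modularity of weight \<open>k\<close> under the full group \<open>SL\<^sub>2(\<int>)\<close>, whose elements are given by
  their four integer entries.\<close>

definition weakly_modular :: "int \<Rightarrow> (complex \<Rightarrow> complex) \<Rightarrow> bool" where
  "weakly_modular k f \<longleftrightarrow>
     (\<forall>(a::int) (b::int) (c::int) (d::int). a * d - b * c = 1 \<longrightarrow>
        (\<forall>z\<in>upper_half_plane.
           f ((of_int a * z + of_int b) / (of_int c * z + of_int d)) =
             (of_int c * z + of_int d) powi k * f z))"

definition has_fourier_expansion :: "(complex \<Rightarrow> complex) \<Rightarrow> (nat \<Rightarrow> complex) \<Rightarrow> bool" where
  "has_fourier_expansion f a \<longleftrightarrow>
     (\<forall>z\<in>upper_half_plane.
        (\<lambda>n. a n * exp (2 * of_real pi * \<i> * of_nat n * z)) sums f z)"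

text \<open>Holomorphy at the (only) cusp \<open>\<infinity>\<close> is the existence of a Fourier expansion without
  negative-index terms. Only the values on the upper half plane are constrained.\<close>

definition modular_form :: "int \<Rightarrow> (complex \<Rightarrow> complex) \<Rightarrow> bool" where
  "modular_form k f \<longleftrightarrow>
     f holomorphic_on upper_half_plane \<and> weakly_modular k f \<and> (\<exists>a. has_fourier_expansion f a)"

definition cusp_form :: "int \<Rightarrow> (complex \<Rightarrow> complex) \<Rightarrow> bool" where
  "cusp_form k f \<longleftrightarrow> modular_form k f \<and> (\<exists>a. has_fourier_expansion f a \<and> a 0 = 0)"

definition coeff_partial_sum :: "(nat \<Rightarrow> complex) \<Rightarrow> nat \<Rightarrow> complex" where
  "coeff_partial_sum a n = (\<Sum>m=1..n. a m)"

end

theory Submission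
  imports Defs "HOL-Probability.Distributions" "HOL-Real_Asymp.Real_Asymp"
begin

text \<open>
  Boundedness of \<open>|f z|\<^sup>2 (Im z)\<^sup>k\<close> and Parseval give \<open>\<Sum>\<^bsub>m \<le> N\<^esub> |a m|\<^sup>2 \<le> C N\<^sup>k\<close>. The modular relation on the
  imaginary axis says that the first Riesz mean \<open>\<Sum>\<^bsub>m \<le> x\<^esub> a m (x - m)\<close> and the absolutely convergent Voronoi
  series \<open>c \<Sum> a m (x / (4 \<pi>\<^sup>2 m))\<^bsup>(k+1)/2\<^esup> J\<^bsub>k+1\<^esub> (4 \<pi> \<surd>(m x))\<close> have the same Laplace transform, so they agree.

  The partial sum \<open>S n\<close> is the difference of the Riesz mean at \<open>n + 1\<close> and \<open>n\<close>. In the Voronoi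
  series the terms with \<open>m \<ge> X\<^sup>4\<close> are negligible, and the difference of the others is the integral over
  \<open>[n, n + 1]\<close> of a finite sum of Bessel functions \<open>J\<^sub>k (4 \<pi> \<surd>(m t))\<close>. Hence the sum of \<open>|S n|\<^sup>2\<close> over an
  interval of length \<open>H\<close> near \<open>X\<close> is controlled by the mean square of that sum, where Lommel's integral gives
  the cross terms exactly: the diagonal contributes \<open>H X\<^bsup>k - 1/2\<^esup>\<close>, and the off-diagonal terms
  \<open>X\<^bsup>k + \<epsilon>\<^esup>\<close>, which is smaller because \<open>H \<ge> X\<^bsup>2/3\<^esup>\<close>.
\<close>

section \<open>Bessel-Clifford functions\<close>

text \<open>The obstacle is convergence. The coefficients are controlled only in mean square, so on
  average by m^((k-1)/2), and the terms with J_k that belong to the partial sum itself are then only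
  of order m^(-3/4). One summation in advance raises the index to k + 1 and improves the order to
  m^(-5/4); the series becomes continuous in x, as uniqueness of Laplace transforms requires.
  Nothing is lost on the way back: the Riesz mean is linear between consecutive integers, with slope
  exactly S n on [n, n + 1].

  The Laplace transform fits because a Riesz term becomes an exponential in s and a Bessel term an
  exponential in 1/s, and z -> -1/z exchanges the two.

  The exponent 4 in X^4 comes from the tail beyond M, which gains only M^(-1/8): M = X^4 brings it
  down to X^(k/2 - 1/4), the size asked for. The harmonic sum and the coefficient sum up to M may
  then cost M^(1/48) each, together X^(1/6), and 1/6 is exactly the gap between 2/3 and 1/2.\<close>

text \<open>In terms of the Bessel function, \<open>J\<^sub>v (2 * sqrt x) = sqrt x ^ v * bessel_clifford v x\<close>.\<close>

definition bessel_clifford :: "nat \<Rightarrow> real \<Rightarrow> real" where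
  "bessel_clifford v x = (\<Sum>j. (-1) ^ j / (fact j * fact (j + v)) * x ^ j)"

lemma bessel_clifford_abs_summable:
  "summable (\<lambda>j. \<bar>(-1) ^ j / (fact j * fact (j + v)) * x ^ j :: real\<bar>)"
proof (rule summable_comparison_test')
  show "summable (\<lambda>j. \<bar>x\<bar> ^ j /\<^sub>R fact j)"
    by (rule summable_exp_generic)
  fix j :: nat
  have "(1::real) \<le> fact (j + v)"
    by (rule fact_ge_1)
  then have "inverse (fact (j + v)) \<le> (1 :: real)"
    by (simp add: inverse_le_1_iff)
  then have "inverse (fact (j + v)) * \<bar>x\<bar> ^ j \<le> 1 * \<bar>x\<bar> ^ j"
    by (rule mult_right_mono) simp
  then show "norm \<bar>(-1) ^ j / (fact j * fact (j + v)) * x ^ j :: real\<bar> \<le> \<bar>x\<bar> ^ j /\<^sub>R fact j"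
    by (simp add: abs_mult power_abs divide_inverse mult.assoc)
qed

lemma bessel_clifford_summable:
  "summable (\<lambda>j. (-1) ^ j / (fact j * fact (j + v)) * x ^ j :: real)"
  by (rule summable_rabs_cancel[OF bessel_clifford_abs_summable])

lemma bessel_clifford_deriv:
  "(bessel_clifford v has_real_derivative - bessel_clifford (Suc v) x) (at x)"
proof -
  have "diffs (\<lambda>j. (-1) ^ j / (fact j * fact (j + v)) :: real) =
      (\<lambda>j. - ((-1) ^ j / (fact j * fact (j + Suc v))))"
    by (rule ext) (simp add: diffs_def divide_simps del: of_nat_Suc)
  then have "(bessel_clifford v has_real_derivative
      (\<Sum>j. - ((-1) ^ j / (fact j * fact (j + Suc v))) * x ^ j)) (at x)"
    using termdiffs_strong_converges_everywhere[OF bessel_clifford_summable[of v], of x]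
    by (simp add: bessel_clifford_def[abs_def])
  moreover have "(\<Sum>j. - ((-1) ^ j / (fact j * fact (j + Suc v))) * x ^ j) =
      - bessel_clifford (Suc v) x"
    using suminf_minus[OF bessel_clifford_summable[of "Suc v" x]]
    by (simp add: bessel_clifford_def)
  ultimately show ?thesis
    by simp
qed

lemmas bessel_clifford_deriv' [derivative_intros] =
  DERIV_chain2[OF bessel_clifford_deriv]

lemma continuous_on_bessel_clifford [continuous_intros]:
  "continuous_on A g \<Longrightarrow> continuous_on A (\<lambda>x. bessel_clifford v (g x))"
  by (rule continuous_on_compose2[OF DERIV_continuous_on[where s = UNIV], OF bessel_clifford_deriv])
     auto

text \<open>In the coefficient of x^j this is (v + 1) + j = j + v + 1. It is the three-term
  recurrence of the Bessel functions; it eliminates the index v + 2, both in Bessel's equation and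
  when the index is lowered by differentiation.\<close>

lemma bessel_clifford_rec:
  "bessel_clifford v x =
     real (Suc v) * bessel_clifford (Suc v) x - x * bessel_clifford (Suc (Suc v)) x"
proof -
  let ?c = "\<lambda>v j. (-1) ^ j / (fact j * fact (j + v)) :: real"
  have s1: "(\<lambda>j. real (Suc v) * (?c (Suc v) j * x ^ j)) sums
      (real (Suc v) * bessel_clifford (Suc v) x)"
    unfolding bessel_clifford_def by (intro sums_mult summable_sums bessel_clifford_summable)
  have "(\<lambda>j. x * (?c (Suc (Suc v)) j * x ^ j)) sums (x * bessel_clifford (Suc (Suc v)) x)"
    unfolding bessel_clifford_def by (intro sums_mult summable_sums bessel_clifford_summable)
  then have s2: "(\<lambda>j. if j = 0 then 0 else
        x * (?c (Suc (Suc v)) (j - 1) * x ^ (j - 1))) sums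
      (x * bessel_clifford (Suc (Suc v)) x)"
    using sums_Suc[of "\<lambda>j. if j = 0 then 0 else
        x * (?c (Suc (Suc v)) (j - 1) * x ^ (j - 1))"] by simp
  have "(\<lambda>j. ?c v j * x ^ j) = (\<lambda>j. real (Suc v) * (?c (Suc v) j * x ^ j) -
      (if j = 0 then 0 else x * (?c (Suc (Suc v)) (j - 1) * x ^ (j - 1))))"
  proof
    fix j
    show "?c v j * x ^ j = real (Suc v) * (?c (Suc v) j * x ^ j) -
      (if j = 0 then 0 else x * (?c (Suc (Suc v)) (j - 1) * x ^ (j - 1)))"
    proof (cases j)
      case (Suc i)
      have nz: "real i + real v + 2 \<noteq> 0" "real i + 1 \<noteq> 0" by linarith+
      have "?c v (Suc i) = real (Suc v) * ?c (Suc v) (Suc i) - ?c (Suc (Suc v)) i"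
        using nz by (simp add: divide_simps) (simp add: algebra_simps)
      then have "?c v (Suc i) * x ^ Suc i =
          (real (Suc v) * ?c (Suc v) (Suc i) - ?c (Suc (Suc v)) i) * x ^ Suc i"
        by simp
      then show ?thesis
        by (simp add: Suc algebra_simps)
    qed simp
  qed
  then show ?thesis
    using sums_unique[OF sums_diff[OF s1 s2]] by (simp add: bessel_clifford_def)
qed

text \<open>With \<open>p = x powr (1/4) * j x\<close> and \<open>q = x powr (-1/4) * l x\<close>, the cross term in the energy
  \<open>p\<^sup>2 + q\<^sup>2 + p * q / (2 * sqrt x)\<close> cancels the leading part of its derivative; what remains is integrable
  up to infinity.\<close>

lemma bessel_type_ode_bounded:
  fixes j l :: "real \<Rightarrow> real"
  assumes j: "\<And>x. x \<ge> 1 \<Longrightarrow> (j has_real_derivative l x / x) (at x)"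
    and l: "\<And>x. x \<ge> 1 \<Longrightarrow> (l has_real_derivative (\<kappa> - x) * j x / x) (at x)"
    and k: "\<kappa> \<ge> 0"
  obtains C where "C > 0" "\<And>x. x \<ge> 1 \<Longrightarrow> \<bar>j x\<bar> \<le> C * x powr (-1/4)"
    "\<And>x. x \<ge> 1 \<Longrightarrow> \<bar>l x\<bar> \<le> C * x powr (1/4)"
proof -
  \<comment> \<open>Chosen with room to spare: the bound for \<open>D\<close> below asks for 3/4 * K
    \<ge> 3/2 * \<kappa> + 1/8.\<close>
  define K where "K = 4 * \<kappa> + 1"
  define Q where "Q x = sqrt x * (j x)\<^sup>2 + (l x)\<^sup>2 / sqrt x + j x * l x / (2 * sqrt x)" for x
  define D where "D x = ((2 * \<kappa> - 1/4) * (j x * l x) + \<kappa> / 2 * (j x)\<^sup>2) / (x * sqrt x)" for x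
  have dQ: "(Q has_real_derivative D x) (at x)" if "x \<ge> 1" for x
  proof -
    define r where "r = sqrt x"
    have r: "r > 0" "x = r * r" "sqrt (r * r) = r" using that by (auto simp: r_def)
    have 1: "((\<lambda>x. sqrt x * (j x)\<^sup>2) has_real_derivative
        (j x)\<^sup>2 / (2 * sqrt x) + 2 * (j x * l x) * sqrt x / x) (at x)"
      using that by (auto intro!: derivative_eq_intros j simp: divide_simps)
    have 2: "((\<lambda>x. (l x)\<^sup>2 / sqrt x) has_real_derivative
        2 * (j x * l x) * (\<kappa> - x) / (x * sqrt x) - (l x)\<^sup>2 / (2 * x * sqrt x)) (at x)"
      using that by (auto intro!: derivative_eq_intros l simp: divide_simps)
    have 3: "((\<lambda>x. j x * l x / (2 * sqrt x)) has_real_derivative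
        ((l x)\<^sup>2 + (\<kappa> - x) * (j x)\<^sup>2) / (2 * x * sqrt x) - j x * l x / (4 * x * sqrt x)) (at x)"
      using that by (auto intro!: derivative_eq_intros j l simp: divide_simps)
        (simp add: algebra_simps power2_eq_square)
    have "(j x)\<^sup>2 / (2 * r) + 2 * (j x * l x) * r / (r * r)
        + (2 * (j x * l x) * (\<kappa> - r * r) / (r * r * r) - (l x)\<^sup>2 / (2 * (r * r) * r))
        + (((l x)\<^sup>2 + (\<kappa> - r * r) * (j x)\<^sup>2) / (2 * (r * r) * r) - j x * l x / (4 * (r * r) * r))
        = ((2 * \<kappa> - 1/4) * (j x * l x) + \<kappa> / 2 * (j x)\<^sup>2) / (r * r * r)"
      using r(1) by (simp add: divide_simps) (simp add: algebra_simps)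
    then have "(j x)\<^sup>2 / (2 * sqrt x) + 2 * (j x * l x) * sqrt x / x
        + (2 * (j x * l x) * (\<kappa> - x) / (x * sqrt x) - (l x)\<^sup>2 / (2 * x * sqrt x))
        + (((l x)\<^sup>2 + (\<kappa> - x) * (j x)\<^sup>2) / (2 * x * sqrt x) - j x * l x / (4 * x * sqrt x)) = D x"
      unfolding D_def r_def using that by simp
    then show ?thesis
      using DERIV_add[OF DERIV_add[OF 1 2] 3] by (simp only: Q_def[abs_def])
  qed
  \<comment> \<open>The cross term is at most a quarter of p^2 + q^2, so the energy stays positive
    definite; 4/3 is the inverse of 1 - 1/4.\<close>
  have pq: "sqrt x * (j x)\<^sup>2 + (l x)\<^sup>2 / sqrt x \<le> 4/3 * Q x"
      "D x \<le> K / (x * sqrt x) * Q x" "Q x \<ge> 0" if "x \<ge> 1" for x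
  proof -
    define r where "r = sqrt x"
    define p q where "p = sqrt r * j x" and "q = l x / sqrt r"
    have r: "r \<ge> 1" "x = r * r" using that by (auto simp: r_def)
    have sr: "sqrt r * sqrt r = r" "sqrt r > 0" using r by auto
    have p2: "sqrt x * (j x)\<^sup>2 = p\<^sup>2" and q2: "(l x)\<^sup>2 / sqrt x = q\<^sup>2" and pq: "j x * l x = p * q"
      using r sr by (auto simp: p_def q_def r_def[symmetric] power_mult_distrib power_divide)
    have j2: "(j x)\<^sup>2 \<le> p\<^sup>2"
      unfolding p2[symmetric] using mult_right_mono[OF r(1), of "(j x)\<^sup>2"] by (simp add: r_def)
    define w where "w = p * q / (2 * r)"
    have Q_eq: "Q x = p\<^sup>2 + q\<^sup>2 + w"
      unfolding Q_def p2 q2 pq w_def by (simp add: r_def)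
    have ab: "\<bar>p * q\<bar> \<le> (p\<^sup>2 + q\<^sup>2) / 2"
      using sum_squares_bound[of "\<bar>p\<bar>" "\<bar>q\<bar>"] by (simp add: abs_mult)
    have "\<bar>p * q\<bar> / (2 * r) \<le> \<bar>p * q\<bar> / 2"
      using r by (intro divide_left_mono) auto
    then have "\<bar>w\<bar> \<le> \<bar>p * q\<bar> / 2"
      using r by (simp add: w_def)
    also have "\<dots> \<le> (p\<^sup>2 + q\<^sup>2) / 2 / 2"
      using ab by (rule divide_right_mono) simp
    finally have "- w \<le> (p\<^sup>2 + q\<^sup>2) / 2 / 2"
      using abs_ge_minus_self order_trans by blast
    then have lower: "3/4 * (p\<^sup>2 + q\<^sup>2) \<le> Q x"
      unfolding Q_eq by (simp add: field_simps)
    then show "sqrt x * (j x)\<^sup>2 + (l x)\<^sup>2 / sqrt x \<le> 4/3 * Q x"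
      unfolding p2 q2 by (simp add: field_simps)
    have "0 \<le> 3/4 * (p\<^sup>2 + q\<^sup>2)" by simp
    then show "Q x \<ge> 0" using lower by (rule order_trans)
    have "(2 * \<kappa> - 1/4) * (p * q) \<le> \<bar>2 * \<kappa> - 1/4\<bar> * \<bar>p * q\<bar>"
      unfolding abs_mult[symmetric] by (rule abs_ge_self)
    also have "\<dots> \<le> (2 * \<kappa> + 1/4) * ((p\<^sup>2 + q\<^sup>2) / 2)"
      using ab k by (intro mult_mono) auto
    moreover have "\<kappa> / 2 * (j x)\<^sup>2 \<le> \<kappa> / 2 * (p\<^sup>2 + q\<^sup>2)"
      using j2 k by (intro mult_left_mono order_trans[OF j2]) auto
    ultimately have "(2 * \<kappa> - 1/4) * (p * q) + \<kappa> / 2 * (j x)\<^sup>2 \<le>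
       (2 * \<kappa> + 1/4) * ((p\<^sup>2 + q\<^sup>2) / 2) + \<kappa> / 2 * (p\<^sup>2 + q\<^sup>2)"
      by (intro add_mono) auto
    also have "\<dots> = (3 / 2 * \<kappa> + 1/8) * (p\<^sup>2 + q\<^sup>2)"
      by (simp add: field_simps)
    also have "\<dots> \<le> (K * (3/4)) * (p\<^sup>2 + q\<^sup>2)"
      using k unfolding K_def by (intro mult_right_mono) auto
    also have "\<dots> = K * (3/4 * (p\<^sup>2 + q\<^sup>2))"
      by simp
    also have "\<dots> \<le> K * Q x"
      using lower k by (intro mult_left_mono) (auto simp: K_def)
    finally show "D x \<le> K / (x * sqrt x) * Q x"
      unfolding D_def pq using that by (simp add: divide_simps)
  qed
  \<comment> \<open>Integrating factor of Gronwall type: the logarithmic derivative of the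
    exponential is -K / x^(3/2), which absorbs the bound for \<open>D\<close>. The factor is at
    least 1 and finite at 1, so a decreasing \<open>R\<close> bounds \<open>Q\<close> on the whole
    half line.\<close>
  define R where "R x = Q x * exp (2 * K / sqrt x)" for x
  have dR: "(R has_real_derivative (D x - K / (x * sqrt x) * Q x) * exp (2 * K / sqrt x)) (at x)"
    if "x \<ge> 1" for x
  proof -
    have sx: "sqrt x * sqrt x = x" "sqrt x > 0" using that by auto
    have "((\<lambda>x. 2 * K / sqrt x) has_real_derivative - (K / (x * sqrt x))) (at x)"
      using that sx by (auto intro!: derivative_eq_intros simp: field_simps)
    then have "((\<lambda>x. exp (2 * K / sqrt x)) has_real_derivative
        exp (2 * K / sqrt x) * - (K / (x * sqrt x))) (at x)"
      by (rule DERIV_fun_exp)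
    then have "(R has_real_derivative D x * exp (2 * K / sqrt x) +
        exp (2 * K / sqrt x) * - (K / (x * sqrt x)) * Q x) (at x)"
      unfolding R_def[abs_def] by (rule DERIV_mult[OF dQ[OF that]])
    moreover have "d * e + e * - c * q = (d - c * q) * e" for d e c q :: real
      by (simp add: algebra_simps)
    ultimately show ?thesis by (simp only:)
  qed
  have R_le: "R x \<le> R 1" if "x \<ge> 1" for x
  proof (rule DERIV_nonpos_imp_nonincreasing[OF that])
    fix y assume "1 \<le> y" "y \<le> x"
    then show "\<exists>d. (R has_real_derivative d) (at y) \<and> d \<le> 0"
      using dR[of y] pq(2)[of y] by (intro exI conjI) (auto intro!: mult_nonpos_nonneg)
  qed
  have Q_le: "Q x \<le> R 1" if "x \<ge> 1" for x
  proof -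
    have "1 \<le> exp (2 * K / sqrt x)" using k that by (auto simp: K_def)
    then have "Q x \<le> R x"
      unfolding R_def using pq(3)[OF that] mult_left_mono by fastforce
    then show ?thesis using R_le[OF that] by simp
  qed
  define C where "C = sqrt (4/3 * R 1) + 1"
  have R1: "R 1 \<ge> 0" using Q_le[of 1] pq(3)[of 1] by simp
  have jl: "\<bar>j x\<bar> \<le> C * x powr (-1/4) \<and> \<bar>l x\<bar> \<le> C * x powr (1/4)" if "x \<ge> 1" for x
  proof -
    have sq: "sqrt x = x powr (1/4) * x powr (1/4)"
      using that by (simp add: powr_half_sqrt[symmetric] powr_add[symmetric])
    have inv: "x powr (-1/4) = 1 / x powr (1/4)" using that by (simp add: powr_minus_divide)
    have pos: "x powr (1/4) > 0" using that by simp
    have b: "sqrt x * (j x)\<^sup>2 + (l x)\<^sup>2 / sqrt x \<le> 4/3 * R 1"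
      using pq(1)[OF that] Q_le[OF that] by (simp add: field_simps)
    have "(x powr (1/4) * \<bar>j x\<bar>)\<^sup>2 \<le> sqrt x * (j x)\<^sup>2 + (l x)\<^sup>2 / sqrt x"
      using that by (simp add: power_mult_distrib power2_eq_square[of "x powr (1/4)"] sq[symmetric])
    then have "(x powr (1/4) * \<bar>j x\<bar>)\<^sup>2 \<le> 4/3 * R 1"
      using b by (rule order_trans)
    then have 1: "x powr (1/4) * \<bar>j x\<bar> \<le> C"
      unfolding C_def using real_le_rsqrt by (simp add: add_increasing2)
    have "(\<bar>l x\<bar> / x powr (1/4))\<^sup>2 \<le> sqrt x * (j x)\<^sup>2 + (l x)\<^sup>2 / sqrt x"
      using that by (simp add: power_divide power2_eq_square[of "x powr (1/4)"] sq[symmetric])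
    then have "(\<bar>l x\<bar> / x powr (1/4))\<^sup>2 \<le> 4/3 * R 1"
      using b by (rule order_trans)
    then have 2: "\<bar>l x\<bar> / x powr (1/4) \<le> C"
      unfolding C_def using real_le_rsqrt by (simp add: add_increasing2)
    show ?thesis using 1 2 pos unfolding inv by (simp add: field_simps)
  qed
  show ?thesis
    by (rule that[of C]) (use jl R1 in \<open>auto simp: C_def intro!: add_nonneg_pos\<close>)
qed

text \<open>This is J_v(2 sqrt x). In this variable J_v(4 pi sqrt(m t)) has the argument 4 pi^2 m t,
  linear in t, so that the differential equations of two terms differ only by a constant multiple of
  the unknown.\<close>

definition bessel_sqrt :: "nat \<Rightarrow> real \<Rightarrow> real" where
  "bessel_sqrt v x = sqrt x ^ v * bessel_clifford v x"

text \<open>The Euler derivative \<open>x * d/dx\<close> of \<open>bessel_sqrt v\<close>.\<close>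

definition bessel_sqrt_euler :: "nat \<Rightarrow> real \<Rightarrow> real" where
  "bessel_sqrt_euler v x =
     sqrt x ^ v * (real v / 2 * bessel_clifford v x - x * bessel_clifford (Suc v) x)"

section \<open>Differential equation and decay of J_v(2 sqrt x)\<close>

lemma sqrt_power_deriv:
  assumes "x > 0"
  shows "((\<lambda>x. sqrt x ^ v) has_real_derivative (real v / 2 * sqrt x ^ v / x)) (at x)"
proof (cases v)
  case (Suc n)
  have "sqrt x * sqrt x = x" "sqrt x > 0" using assms by auto
  then have "real v * (inverse (sqrt x) / 2 * sqrt x ^ (v - Suc 0)) = real v / 2 * sqrt x ^ v / x"
    using assms Suc by (simp add: divide_simps)
  then show ?thesis
    using DERIV_power[OF DERIV_real_sqrt[OF assms], of v] by (simp add: mult.commute)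
qed simp

lemma bessel_sqrt_deriv:
  assumes "x > 0"
  shows "(bessel_sqrt v has_real_derivative bessel_sqrt_euler v x / x) (at x)"
proof -
  have "(bessel_sqrt v has_real_derivative
      real v / 2 * sqrt x ^ v / x * bessel_clifford v x
      + - bessel_clifford (Suc v) x * sqrt x ^ v) (at x)"
    unfolding bessel_sqrt_def[abs_def]
    by (rule DERIV_mult[OF sqrt_power_deriv[OF assms] bessel_clifford_deriv])
  then show ?thesis
    using assms by (simp add: bessel_sqrt_euler_def field_simps)
qed

text \<open>Bessel's equation in Euler form. With the preceding lemma it is the first-order system
  of \<open>bessel_type_ode_bounded\<close>, with \<kappa> = v^2 / 4.\<close>

lemma bessel_sqrt_euler_deriv:
  assumes "x > 0"
  shows "(bessel_sqrt_euler v has_real_derivative ((real v)\<^sup>2 / 4 - x) * bessel_sqrt v x / x) (at x)"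
proof -
  let ?B = bessel_clifford
  have "((\<lambda>x. real v / 2 * ?B v x - x * ?B (Suc v) x) has_real_derivative
      real v / 2 * - ?B (Suc v) x - (?B (Suc v) x + x * - ?B (Suc (Suc v)) x)) (at x)"
    by (auto intro!: derivative_eq_intros)
  then have "(bessel_sqrt_euler v has_real_derivative
      real v / 2 * sqrt x ^ v / x * (real v / 2 * ?B v x - x * ?B (Suc v) x) +
      (real v / 2 * - ?B (Suc v) x - (?B (Suc v) x + x * - ?B (Suc (Suc v)) x)) * sqrt x ^ v) (at x)"
    unfolding bessel_sqrt_euler_def[abs_def]
    by (rule DERIV_mult[OF sqrt_power_deriv[OF assms]])
  moreover have "real v / 2 * sqrt x ^ v / x * (real v / 2 * ?B v x - x * ?B (Suc v) x) +
      (real v / 2 * - ?B (Suc v) x - (?B (Suc v) x + x * - ?B (Suc (Suc v)) x)) * sqrt x ^ v =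
      sqrt x ^ v * ((real v)\<^sup>2 / 4 * ?B v x -
        x * (real (Suc v) * ?B (Suc v) x - x * ?B (Suc (Suc v)) x)) / x"
    using assms by (simp add: field_simps power2_eq_square)
  moreover have "\<dots> = ((real v)\<^sup>2 / 4 - x) * bessel_sqrt v x / x"
    unfolding bessel_clifford_rec[symmetric] by (simp add: bessel_sqrt_def algebra_simps)
  ultimately show ?thesis by (simp only:)
qed

lemma bessel_sqrt_bounds:
  obtains C where "C > 0" "\<And>x. x \<ge> 1 \<Longrightarrow> \<bar>bessel_sqrt v x\<bar> \<le> C * x powr (-1/4)"
    "\<And>x. x \<ge> 1 \<Longrightarrow> \<bar>bessel_sqrt_euler v x\<bar> \<le> C * x powr (1/4)"
  by (rule bessel_type_ode_bounded[of "bessel_sqrt v" "bessel_sqrt_euler v" "(real v)\<^sup>2 / 4"])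
     (auto intro!: bessel_sqrt_deriv bessel_sqrt_euler_deriv)

text \<open>The decay from 1 onwards extends down to 0 because the exponent is negative: on (0, 1]
  the power is at least 1, and the function is bounded there by compactness. The full range is
  wanted because the Laplace integrals start at 0.\<close>

lemma bessel_clifford_bound:
  obtains C where "C > 0"
    "\<And>x. x > 0 \<Longrightarrow> \<bar>bessel_clifford v x\<bar> \<le> C * x powr (- (real v / 2 + 1/4))"
proof -
  obtain C where C: "C > 0" "\<And>x. x \<ge> 1 \<Longrightarrow> \<bar>bessel_sqrt v x\<bar> \<le> C * x powr (-1/4)"
    using bessel_sqrt_bounds[of v] by metis
  have "compact (bessel_clifford v ` {0..1})"
    by (intro compact_continuous_image continuous_intros) auto
  then obtain B where "\<forall>y \<in> bessel_clifford v ` {0..1}. norm y \<le> B"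
    using compact_imp_bounded bounded_iff by metis
  then have B: "\<bar>bessel_clifford v x\<bar> \<le> B" if "x \<in> {0..1}" for x
    using that by auto
  show ?thesis
  proof (rule that[of "max C B"])
    show "max C B > 0" using C by simp
    fix x :: real assume x: "x > 0"
    show "\<bar>bessel_clifford v x\<bar> \<le> max C B * x powr (- (real v / 2 + 1/4))"
    proof (cases "x \<ge> 1")
      case True
      have s: "sqrt x ^ v = x powr (real v / 2)"
        using x by (simp add: powr_half_sqrt[symmetric] powr_powr powr_realpow[symmetric])
      have "x powr (real v / 2) * \<bar>bessel_clifford v x\<bar> \<le> C * x powr (-1/4)"
        using C(2)[OF True] x by (simp add: bessel_sqrt_def abs_mult s)
      then have "\<bar>bessel_clifford v x\<bar> \<le> C * x powr (-1/4) * x powr (- (real v / 2))"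
        using x by (simp add: powr_minus field_simps)
      also have "\<dots> = C * x powr (- (real v / 2 + 1/4))"
        by (simp add: powr_add[symmetric] mult.assoc add.commute)
      also have "\<dots> \<le> max C B * x powr (- (real v / 2 + 1/4))"
        by (intro mult_right_mono) auto
      finally show ?thesis .
    next
      case False
      have "x powr (- (real v / 2 + 1/4)) \<ge> x powr 0"
        using x False by (intro powr_mono') auto
      then have "1 \<le> x powr (- (real v / 2 + 1/4))" using x by simp
      moreover have "\<bar>bessel_clifford v x\<bar> \<le> max C B"
        using B[of x] x False by auto
      ultimately show ?thesis
        using C(1) mult_mono[of "\<bar>bessel_clifford v x\<bar>" "max C B" 1] by simp
    qed
  qed
qed

section \<open>Size of the Fourier coefficients\<close>

lemma upper_half_plane_iff [simp]: "z \<in> upper_half_plane \<longleftrightarrow> 0 < Im z"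
  by (simp add: upper_half_plane_def)

lemma power_le_fact_exp:
  fixes y :: real
  assumes "y \<ge> 0"
  shows "y ^ n \<le> fact n * exp y"
proof -
  have "(\<Sum>i\<in>{n}. y ^ i /\<^sub>R fact i) \<le> exp y"
    unfolding exp_def using assms
    by (intro sum_le_suminf summable_exp_generic) auto
  then show ?thesis by (simp add: field_simps)
qed

text \<open>Orthogonality of the N-th roots of unity. The finite form uses only the values of a
  truncated expansion at N equidistant points of a period.\<close>

lemma discrete_parseval:
  fixes b :: "nat \<Rightarrow> complex"
  assumes N: "N > 0"
  shows "(\<Sum>j<N. (cmod (\<Sum>n<N. b n * cis (2 * pi * real n * (real j / real N))))\<^sup>2) =
    real N * (\<Sum>n<N. (cmod (b n))\<^sup>2)"
proof -
  define z where "z n = cis (2 * pi * real n / real N)" for n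
  have pow: "cis (2 * pi * real n * (real j / real N)) = z n ^ j" for n j
    unfolding z_def Complex.DeMoivre by (rule arg_cong[where f = cis]) simp
  have zN: "z n ^ N = 1" for n
    using N by (simp add: z_def Complex.DeMoivre)
  have inj: "z n \<noteq> z m" if "n < N" "m < N" "n \<noteq> m" for n m
    using Complex.bij_betw_roots_unity[OF N] that unfolding bij_betw_def inj_on_def z_def by auto
  have z_cnj: "z n * cnj (z n) = 1" for n
    by (simp add: z_def cis_cnj cis_mult)
  have orth: "(\<Sum>j<N. z n ^ j * cnj (z m) ^ j) = (if n = m then of_nat N else 0)"
    if "n < N" "m < N" for n m
  proof (cases "n = m")
    case True
    then show ?thesis by (simp add: power_mult_distrib[symmetric] z_cnj)
  next
    case False
    define w where "w = z n * cnj (z m)"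
    have "w * z m = z n"
      using z_cnj[of m] by (simp add: w_def mult_ac)
    then have "w \<noteq> 1"
      using inj[OF that False] by auto
    moreover have "w ^ N = 1"
      by (simp add: w_def power_mult_distrib zN complex_cnj_power[symmetric] del: complex_cnj_power)
    ultimately show ?thesis
      using False geometric_sum[of w N] by (simp add: w_def power_mult_distrib)
  qed
  have "complex_of_real (\<Sum>j<N. (cmod (\<Sum>n<N. b n * z n ^ j))\<^sup>2) =
      (\<Sum>j<N. \<Sum>n<N. \<Sum>m<N. b n * cnj (b m) * (z n ^ j * cnj (z m) ^ j))"
    unfolding of_real_sum complex_norm_square cnj_sum sum_product by (simp add: mult_ac)
  also have "\<dots> = (\<Sum>n<N. \<Sum>j<N. \<Sum>m<N. b n * cnj (b m) * (z n ^ j * cnj (z m) ^ j))"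
    by (rule sum.swap)
  also have "\<dots> = (\<Sum>n<N. \<Sum>m<N. \<Sum>j<N. b n * cnj (b m) * (z n ^ j * cnj (z m) ^ j))"
    by (rule sum.cong[OF refl], rule sum.swap)
  also have "\<dots> = (\<Sum>n<N. \<Sum>m<N. b n * cnj (b m) * (if n = m then of_nat N else 0))"
    by (intro sum.cong refl) (simp add: sum_distrib_left[symmetric] orth)
  also have "\<dots> = (\<Sum>n<N. \<Sum>m<N. if n = m then b n * cnj (b n) * of_nat N else 0)"
    by (intro sum.cong refl) simp
  also have "\<dots> = (\<Sum>n<N. b n * cnj (b n) * of_nat N)"
    by (intro sum.cong refl) simp
  also have "\<dots> = complex_of_real (real N * (\<Sum>n<N. (cmod (b n))\<^sup>2))"
    unfolding of_real_mult of_real_sum complex_norm_square sum_distrib_left by (simp add: mult_ac)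
  finally show ?thesis
    unfolding pow of_real_eq_iff .
qed

lemma Im_moebius:
  fixes a b c d :: int
  assumes "a * d - b * c = 1"
  shows "Im ((of_int a * z + of_int b) / (of_int c * z + of_int d)) =
    Im z / (cmod (of_int c * z + of_int d))\<^sup>2"
proof -
  have det: "real_of_int a * of_int d - of_int b * of_int c = 1"
    using assms by (metis of_int_1 of_int_diff of_int_mult)
  have "of_int a * Im z * (of_int c * Re z + of_int d) -
      (of_int a * Re z + of_int b) * (of_int c * Im z) =
      Im z * (real_of_int a * of_int d - of_int b * of_int c)"
    by (simp add: algebra_simps)
  then show ?thesis
    by (simp add: Im_divide cmod_power2 det)
qed

text \<open>Dirichlet approximation takes the place of a fundamental domain. With c at most about
  y^(-1/2) and |c x - h| \<le> y^(1/2), the square of |c z - h| is at most y + 4 y; hence the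
  constant 1/5.\<close>

lemma exists_moebius_Im_ge:
  assumes "0 < Im z"
  obtains a b c d :: int where "a * d - b * c = 1"
    "1/5 \<le> Im z / (cmod (of_int c * z + of_int d))\<^sup>2" "of_int c * z + of_int d \<noteq> 0"
proof (cases "Im z < 1")
  case False
  show ?thesis by (rule that[of 1 1 0 0]) (use False in auto)
next
  case True
  define x y where "x = Re z" and "y = Im z"
  define r where "r = sqrt y"
  have y: "0 < y" "y < 1" using True assms by (auto simp: y_def)
  have r: "0 < r" "r < 1" "y = r\<^sup>2" using y by (auto simp: r_def)
  define N where "N = nat \<lceil>1 / r\<rceil>"
  have N: "1 / r \<le> real N" "real N \<le> 1 / r + 1" "N > 0"
    using r unfolding N_def by (auto simp: of_nat_ceiling)
  obtain h c where hc: "coprime h c" "0 < c" "c \<le> int N" "\<bar>of_int c * x - of_int h\<bar> < 1 / real N"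
    using Dirichlet_approx_coprime[OF N(3)] by blast
  obtain u v where uv: "u * h + v * c = 1"
    using bezout_int[of h c] hc(1) by (auto simp: coprime_iff_gcd_eq_1)
  have "1 / real N \<le> r"
    using N r by (simp add: divide_simps mult.commute)
  then have 1: "(of_int c * x - of_int h)\<^sup>2 \<le> r\<^sup>2"
    using hc(4) by (intro power2_le_iff_abs_le[THEN iffD2]) auto
  have "of_int c * r \<le> (1 / r + 1) * r"
    using hc(3) N(2) r(1) by (intro mult_right_mono) (linarith | simp)+
  also have "\<dots> \<le> 2" using r by (simp add: algebra_simps)
  finally have "(of_int c * r)\<^sup>2 \<le> 2\<^sup>2"
    using hc(2) r(1) by (intro power_mono) auto
  then have "(of_int c * r)\<^sup>2 * r\<^sup>2 \<le> 2\<^sup>2 * r\<^sup>2"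
    by (intro mult_right_mono) auto
  then have 2: "(of_int c * y)\<^sup>2 \<le> 4 * r\<^sup>2"
    unfolding r(3) by (simp add: power2_eq_square mult_ac)
  let ?w = "of_int c * z + of_int (- h)"
  have cm: "(cmod ?w)\<^sup>2 = (of_int c * x - of_int h)\<^sup>2 + (of_int c * y)\<^sup>2"
    by (simp add: cmod_power2 x_def y_def)
  have pos: "0 < (cmod ?w)\<^sup>2"
    unfolding cm using hc(2) y(1) by (intro add_nonneg_pos) auto
  have "(cmod ?w)\<^sup>2 \<le> 5 * y"
    unfolding cm using 1 2 r(3) by linarith
  then have "1/5 \<le> Im z / (cmod ?w)\<^sup>2"
    using pos by (simp add: divide_simps y_def)
  moreover have "?w \<noteq> 0" using pos by auto
  \<comment> \<open>The bottom row (c, -h) is completed by Bezout. The positional instantiation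
    follows the first occurrence in the determinant equation, that is, in the order a, d, b,
    c.\<close>
  ultimately show ?thesis
    using that[of "- u" "- h" "- v" c] uv by simp
qed

text \<open>Abel summation: the weights drop by at most s n^(-s-1) from one index to the next, so
  the partial sums enter through the series of n^(p-s-1), convergent since p < s.\<close>

lemma summable_weight_powr:
  fixes b :: "nat \<Rightarrow> real"
  assumes nonneg: "\<And>n. b n \<ge> 0"
    and bound: "\<And>N. (\<Sum>n<N. b n) \<le> C * real N powr p"
    and p: "0 < p" "p < s"
  shows "summable (\<lambda>n. b n * real (Suc n) powr (- s))"
proof -
  define w where "w n = real (Suc n) powr (- s)" for n
  define T where "T N = (\<Sum>n<N. b n)" for N
  have T0: "T N \<ge> 0" for N unfolding T_def by (intro sum_nonneg nonneg)
  have C0: "C \<ge> 0" using T0[of 1] bound[of 1] by (simp add: T_def)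
  have abel: "(\<Sum>n<N. b n * w n) = T N * w N + (\<Sum>n<N. T (Suc n) * (w n - w (Suc n)))" for N
    by (induction N) (simp_all add: T_def algebra_simps)
  have dw: "w n - w (Suc n) \<le> s * real (Suc n) powr (- s - 1)" for n
  proof -
    have "\<exists>\<xi>>real (Suc n). \<xi> < real (Suc (Suc n)) \<and>
        real (Suc (Suc n)) powr (- s) - real (Suc n) powr (- s) =
        (real (Suc (Suc n)) - real (Suc n)) * (- s * \<xi> powr (- s - 1))"
      by (intro MVT2) (auto intro!: derivative_eq_intros)
    then obtain \<xi> where \<xi>: "\<xi> > real (Suc n)" "w n - w (Suc n) = s * \<xi> powr (- s - 1)"
      by (auto simp: w_def)
    have "\<xi> powr (- s - 1) \<le> real (Suc n) powr (- s - 1)"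
      using \<xi>(1) p by (intro powr_mono2') auto
    then show ?thesis using \<xi>(2) p by (simp add: mult_left_mono)
  qed
  have sm: "summable (\<lambda>n. C * s * real (Suc n) powr (p - s - 1))"
    using p by (subst summable_Suc_iff) (intro summable_mult, simp add: summable_real_powr_iff)
  have step: "T (Suc n) * (w n - w (Suc n)) \<le> C * s * real (Suc n) powr (p - s - 1)" for n
  proof -
    have "T (Suc n) * (w n - w (Suc n)) \<le> T (Suc n) * (s * real (Suc n) powr (- s - 1))"
      by (intro mult_left_mono dw T0)
    also have "\<dots> \<le> C * real (Suc n) powr p * (s * real (Suc n) powr (- s - 1))"
      using bound[of "Suc n"] p unfolding T_def by (intro mult_right_mono) auto
    also have "\<dots> = C * s * (real (Suc n) powr p * real (Suc n) powr (- s - 1))"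
      by simp
    also have "\<dots> = C * s * real (Suc n) powr (p - s - 1)"
      by (simp add: powr_add[symmetric] algebra_simps)
    finally show ?thesis .
  qed
  have first: "T N * w N \<le> C" for N
  proof (cases "N = 0")
    case True
    then show ?thesis using C0 by (simp add: T_def)
  next
    case False
    have "T N * w N \<le> (C * real N powr p) * real N powr (- p)"
    proof (intro mult_mono)
      have "w N \<le> real (Suc N) powr (- p)"
        unfolding w_def using p by (intro powr_mono) auto
      also have "\<dots> \<le> real N powr (- p)"
        using p False by (intro powr_mono2') auto
      finally show "w N \<le> real N powr (- p)" .
    qed (use bound C0 in \<open>auto simp: T_def w_def\<close>)
    also have "\<dots> = C"
      using False by (simp add: powr_minus)
    finally show ?thesis .
  qed
  have nn: "0 \<le> C * s * real (Suc n) powr (p - s - 1)" for n using C0 p by simp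
  have "(\<Sum>n<N. b n * w n) \<le> C + (\<Sum>n. C * s * real (Suc n) powr (p - s - 1))" for N
  proof -
    have "(\<Sum>n<N. T (Suc n) * (w n - w (Suc n))) \<le> (\<Sum>n<N. C * s * real (Suc n) powr (p - s - 1))"
      by (intro sum_mono step)
    also have "\<dots> \<le> (\<Sum>n. C * s * real (Suc n) powr (p - s - 1))"
      by (rule sum_le_suminf[OF sm]) (use nn in auto)
    finally show ?thesis unfolding abel using first[of N] by linarith
  qed
  then have "summable (\<lambda>n. b n * w n)"
    by (intro summableI_nonneg_bounded) (auto simp: w_def nonneg)
  then show ?thesis by (simp add: w_def)
qed

text \<open>\<open>\<alpha> n\<close> is the coefficient of exp(2 pi i (n + 1) z). The shift by one
  builds in the vanishing at the cusp and keeps every index \<open>Suc n\<close> positive, so that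
  it can carry real powers.\<close>

locale cusp_expansion =
  fixes f :: "complex \<Rightarrow> complex" and \<alpha> :: "nat \<Rightarrow> complex" and k :: nat
  assumes k_pos: "0 < k"
    and modular: "weakly_modular (int k) f"
    and expansion: "0 < Im z \<Longrightarrow>
      (\<lambda>n. \<alpha> n * exp (2 * of_real pi * \<i> * of_nat (Suc n) * z)) sums f z"
begin

section \<open>Hecke's bound and the mean square of the coefficients\<close>

lemma cmod_term:
  "cmod (exp (2 * of_real pi * \<i> * of_nat (Suc n) * z)) = exp (- (2 * pi * real (Suc n) * Im z))"
  by (simp add: norm_exp_eq_Re)

text \<open>Convergence at height y/2 bounds the terms there; going up to height y leaves another
  factor exp(- pi y (n + 1)), which is geometric.\<close>

lemma abs_summable:
  assumes "y > 0"
  shows "summable (\<lambda>n. cmod (\<alpha> n) * exp (- (2 * pi * real (Suc n) * y)))"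
proof -
  have "Im (\<i> * of_real (y / 2)) > 0" using assms by simp
  from sums_summable[OF expansion[OF this]]
  have "Bseq (\<lambda>n. \<alpha> n * exp (2 * of_real pi * \<i> * of_nat (Suc n) * (\<i> * of_real (y / 2))))"
    using summable_LIMSEQ_zero convergentI convergent_imp_Bseq by blast
  then obtain B where B: "\<And>n. cmod (\<alpha> n * exp (2 * of_real pi * \<i> * of_nat (Suc n) * (\<i> * of_real (y / 2)))) \<le> B"
    by (auto simp: Bseq_def)
  define q where "q = exp (- (pi * y))"
  have q: "0 < q" "q < 1" using assms by (auto simp: q_def)
  have e: "exp (- (pi * real (Suc n) * y)) = q ^ Suc n" for n
    unfolding q_def exp_of_nat_mult[symmetric] by (simp add: mult_ac)
  show ?thesis
  proof (rule summable_comparison_test')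
    show "summable (\<lambda>n. B * q ^ Suc n)"
      using q by (intro summable_mult) (simp add: summable_mult summable_geometric)
    fix n
    have "cmod (\<alpha> n) * exp (- (pi * real (Suc n) * y)) \<le> B"
      using B[of n] unfolding norm_mult cmod_term by (simp add: mult.assoc)
    then have "cmod (\<alpha> n) * q ^ Suc n * q ^ Suc n \<le> B * q ^ Suc n"
      unfolding e using q by (intro mult_right_mono) auto
    moreover have "exp (- (2 * pi * real (Suc n) * y)) = q ^ Suc n * q ^ Suc n"
      unfolding e[symmetric] by (simp add: exp_add[symmetric] algebra_simps)
    ultimately show "norm (cmod (\<alpha> n) * exp (- (2 * pi * real (Suc n) * y))) \<le> B * q ^ Suc n"
      using q by (simp add: abs_mult mult.assoc del: power_Suc of_nat_Suc)
  qed
qed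

lemma modular_norm:
  assumes z: "0 < Im z" and det: "a * d - b * c = 1" and nz: "of_int c * z + of_int d \<noteq> 0"
  defines "w \<equiv> (of_int a * z + of_int b) / (of_int c * z + of_int d)"
  shows "(cmod (f w))\<^sup>2 * Im w ^ k = (cmod (f z))\<^sup>2 * Im z ^ k"
proof -
  let ?j = "of_int c * z + of_int d"
  have "f w = ?j powi int k * f z"
    using modular det z unfolding weakly_modular_def w_def by simp
  then have "cmod (f w) = cmod ?j ^ k * cmod (f z)"
    by (simp add: norm_mult norm_power)
  moreover have "Im w = Im z / (cmod ?j)\<^sup>2"
    unfolding w_def by (rule Im_moebius[OF det])
  ultimately show ?thesis
    using nz by (simp add: power_mult_distrib power_divide power_mult[symmetric] mult.commute)
qed

text \<open>The quantity is invariant, so a Moebius map allows Im z \<ge> 1/5. There the expansion,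
  whose first term is already exponentially small in y, beats the power y^k.\<close>

lemma hecke_bound:
  obtains C where "C > 0" "\<And>z. 0 < Im z \<Longrightarrow> (cmod (f z))\<^sup>2 * Im z ^ k \<le> C"
proof -
  \<comment> \<open>The reference height 1/10 lies below 1/5. As \<open>Suc n\<close> is at least 1,
    each term at height y is at most exp(-2 pi (y - 1/10)) times its value at height 1/10; squared,
    this factor absorbs y^k \<le> k! exp y.\<close>
  define A where "A = (\<Sum>n. cmod (\<alpha> n) * exp (- (2 * pi * real (Suc n) * (1/10))))"
  have A0: "A \<ge> 0" unfolding A_def by (intro suminf_nonneg abs_summable) auto
  define C where "C = (fact k * exp pi * A\<^sup>2) + 1"
  have high: "(cmod (f z))\<^sup>2 * Im z ^ k \<le> C" if "Im z \<ge> 1/5" for z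
  proof -
    define y where "y = Im z"
    have y: "y \<ge> 1/5" using that by (simp add: y_def)
    have le: "cmod (\<alpha> n) * exp (- (2 * pi * real (Suc n) * y)) \<le>
        exp (- (2 * pi * (y - 1/10))) * (cmod (\<alpha> n) * exp (- (2 * pi * real (Suc n) * (1/10))))" for n
    proof -
      have "1 * (y - 1/10) \<le> real (Suc n) * (y - 1/10)"
        using y by (intro mult_right_mono) auto
      then have "2 * pi * (1 * (y - 1/10)) \<le> 2 * pi * (real (Suc n) * (y - 1/10))"
        by (intro mult_left_mono) auto
      then have "exp (- (2 * pi * real (Suc n) * y)) \<le>
          exp (- (2 * pi * (y - 1/10)) + - (2 * pi * real (Suc n) * (1/10)))"
        unfolding exp_le_cancel_iff by (simp add: algebra_simps)
      from mult_left_mono[OF this norm_ge_zero[of "\<alpha> n"]] show ?thesis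
        by (simp only: exp_add mult.left_commute)
    qed
    have "cmod (f z) \<le> (\<Sum>n. cmod (\<alpha> n) * exp (- (2 * pi * real (Suc n) * y)))"
    proof -
      have "f z = (\<Sum>n. \<alpha> n * exp (2 * of_real pi * \<i> * of_nat (Suc n) * z))"
        using expansion[of z] y by (simp add: sums_iff y_def)
      also have "cmod \<dots> \<le> (\<Sum>n. cmod (\<alpha> n * exp (2 * of_real pi * \<i> * of_nat (Suc n) * z)))"
        using abs_summable[of y] y
        by (intro summable_norm) (simp add: norm_mult cmod_term y_def del: of_nat_Suc)
      finally show ?thesis by (simp only: norm_mult cmod_term y_def)
    qed
    also have "\<dots> \<le> exp (- (2 * pi * (y - 1/10))) * A"
      unfolding A_def using y
      by (subst suminf_mult[symmetric], (intro abs_summable, simp))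
         (intro suminf_le[OF le] abs_summable summable_mult; simp)
    finally have "(cmod (f z))\<^sup>2 \<le> (exp (- (2 * pi * (y - 1/10))) * A)\<^sup>2"
      by (intro power_mono) auto
    also have "\<dots> = exp (- (4 * pi * (y - 1/10))) * A\<^sup>2"
      by (simp add: power_mult_distrib power2_eq_square exp_add[symmetric] algebra_simps)
    finally have 1: "(cmod (f z))\<^sup>2 \<le> exp (- (4 * pi * (y - 1/10))) * A\<^sup>2" .
    have "(cmod (f z))\<^sup>2 * y ^ k \<le> (exp (- (4 * pi * (y - 1/10))) * A\<^sup>2) * (fact k * exp y)"
      using y by (intro mult_mono 1 power_le_fact_exp) auto
    also have "\<dots> = fact k * A\<^sup>2 * exp (y - 4 * pi * (y - 1/10))"
      unfolding diff_conv_add_uminus[of y] exp_add by (simp only: mult_ac)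
    also have "\<dots> \<le> fact k * A\<^sup>2 * exp pi"
    proof (intro mult_left_mono)
      have "y \<le> 4 * pi * y" using pi_gt3 y mult_right_mono[of 1 "4 * pi" y] by simp
      then have "(y - 4 * pi * y) + pi * (2/5) \<le> 0 + pi * 1"
        by (intro add_mono mult_left_mono) auto
      moreover have "y - 4 * pi * (y - 1/10) = (y - 4 * pi * y) + pi * (2/5)"
        by (simp add: algebra_simps)
      ultimately show "exp (y - 4 * pi * (y - 1/10)) \<le> exp pi"
        by simp
    qed auto
    also have "\<dots> \<le> C" by (simp add: C_def mult_ac)
    finally show ?thesis by (simp add: y_def)
  qed
  show ?thesis
  proof (rule that[of C])
    show "C > 0" unfolding C_def by (intro add_nonneg_pos) auto
    fix z assume z: "0 < Im z"
    obtain a b c d :: int where abcd: "a * d - b * c = 1"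
      "1/5 \<le> Im z / (cmod (of_int c * z + of_int d))\<^sup>2" "of_int c * z + of_int d \<noteq> 0"
      by (rule exists_moebius_Im_ge[OF z])
    show "(cmod (f z))\<^sup>2 * Im z ^ k \<le> C"
      by (rule ord_eq_le_trans[OF modular_norm[OF z abcd(1,3), symmetric] high])
         (use abcd(2) in \<open>simp only: Im_moebius[OF abcd(1)]\<close>)
  qed
qed

text \<open>On the horizontal line at height y the function is O(y^(-k/2)). Parseval turns this into
  a weighted mean square of the coefficients, and y = 1/N makes the weights bounded below for n <
  N.\<close>

lemma rankin_bound:
  obtains C where "C > 0" "\<And>N. (\<Sum>n<N. (cmod (\<alpha> n))\<^sup>2) \<le> C * real N ^ k"
proof -
  obtain C where C: "C > 0" "\<And>z. 0 < Im z \<Longrightarrow> (cmod (f z))\<^sup>2 * Im z ^ k \<le> C"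
    using hecke_bound by blast
  have main: "(\<Sum>n<N. (cmod (\<alpha> n) * exp (- (2 * pi * real (Suc n) * y)))\<^sup>2) \<le> C / y ^ k"
    if y: "y > 0" for y N
  proof -
    define b where "b n = \<alpha> n * of_real (exp (- (2 * pi * real (Suc n) * y)))" for n
    define F where "F x = f (Complex x y)" for x
    \<comment> \<open>Truncation error after L terms, uniform in x. A polynomial of L terms sampled
      at L points obeys the discrete Parseval identity exactly, and L tends to infinity at fixed y,
      which removes the error.\<close>
    define \<epsilon> where "\<epsilon> L = (\<Sum>n. cmod (b (n + L)))" for L
    have nb: "cmod (b n) = cmod (\<alpha> n) * exp (- (2 * pi * real (Suc n) * y))" for n
      by (simp add: b_def norm_mult)
    have sb: "summable (\<lambda>n. cmod (b n))"
      unfolding nb by (rule abs_summable[OF y])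
    have F_le: "cmod (F x) \<le> sqrt (C / y ^ k)" for x
      using C(2)[of "Complex x y"] y unfolding F_def
      by (intro real_le_rsqrt) (simp add: field_simps)
    have term_eq: "\<alpha> n * exp (2 * of_real pi * \<i> * of_nat (Suc n) * Complex x y) =
        b n * cis (2 * pi * real (Suc n) * x)" for n x
    proof -
      have "2 * of_real pi * \<i> * of_nat (Suc n) * Complex x y =
         of_real (- (2 * pi * real (Suc n) * y)) + \<i> * of_real (2 * pi * real (Suc n) * x)"
        by (simp add: complex_eq_iff)
      then show ?thesis
        unfolding b_def cis_conv_exp exp_of_real[symmetric] by (simp only: exp_add mult.assoc)
    qed
    have approx: "cmod (\<Sum>n<L. b n * cis (2 * pi * real (Suc n) * x)) \<le> sqrt (C / y ^ k) + \<epsilon> L" for L x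
    proof -
      have s: "(\<lambda>n. b n * cis (2 * pi * real (Suc n) * x)) sums F x"
        using expansion[of "Complex x y"] y unfolding term_eq F_def by simp
      have sn: "summable (\<lambda>n. cmod (b (n + L) * cis (2 * pi * real (Suc (n + L)) * x)))"
        using summable_ignore_initial_segment[OF sb, of L] by (simp add: norm_mult)
      have "F x = (\<Sum>n. b (n + L) * cis (2 * pi * real (Suc (n + L)) * x)) +
          (\<Sum>n<L. b n * cis (2 * pi * real (Suc n) * x))"
        using suminf_split_initial_segment[OF sums_summable[OF s], of L] sums_unique[OF s] by simp
      then have "(\<Sum>n<L. b n * cis (2 * pi * real (Suc n) * x)) =
          F x - (\<Sum>n. b (n + L) * cis (2 * pi * real (Suc (n + L)) * x))"
        by simp
      also have "cmod \<dots> \<le> cmod (F x) + cmod (\<Sum>n. b (n + L) * cis (2 * pi * real (Suc (n + L)) * x))"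
        by (rule norm_triangle_ineq4)
      also have "\<dots> \<le> sqrt (C / y ^ k) + \<epsilon> L"
        using F_le[of x] summable_norm[OF sn] by (intro add_mono) (auto simp: \<epsilon>_def norm_mult)
      finally show ?thesis .
    qed
    have \<epsilon>0: "\<epsilon> \<longlonglongrightarrow> 0"
      unfolding \<epsilon>_def by (rule suminf_exist_split2[OF sb])
    have "(\<Sum>n<N. (cmod (b n))\<^sup>2) \<le> (sqrt (C / y ^ k) + 0)\<^sup>2"
    proof (rule tendsto_lowerbound)
      show "(\<lambda>L. (sqrt (C / y ^ k) + \<epsilon> L)\<^sup>2) \<longlonglongrightarrow> (sqrt (C / y ^ k) + 0)\<^sup>2"
        by (intro tendsto_intros \<epsilon>0)
      show "\<forall>\<^sub>F L in sequentially. (\<Sum>n<N. (cmod (b n))\<^sup>2) \<le> (sqrt (C / y ^ k) + \<epsilon> L)\<^sup>2"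
        using eventually_ge_at_top[of "Suc N"]
      proof eventually_elim
        case (elim L)
        have L: "L > 0" using elim by simp
        have "real L * (\<Sum>n<N. (cmod (b n))\<^sup>2) \<le> real L * (\<Sum>n<L. (cmod (b n))\<^sup>2)"
          using elim by (intro mult_left_mono sum_mono2) auto
        also have "\<dots> = (\<Sum>j<L. (cmod (\<Sum>n<L. b n * cis (2 * pi * real n * (real j / real L))))\<^sup>2)"
          by (rule discrete_parseval[OF L, symmetric])
        also have "\<dots> \<le> (\<Sum>j<L. (sqrt (C / y ^ k) + \<epsilon> L)\<^sup>2)"
        proof (intro sum_mono power_mono)
          fix j
          let ?x = "real j / real L"
          \<comment> \<open>The frequencies of the expansion start at 1, those of the Parseval
            identity at 0; the difference is a common factor of modulus 1.\<close>
          have "(\<Sum>n<L. b n * cis (2 * pi * real (Suc n) * ?x)) =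
              (\<Sum>n<L. b n * cis (2 * pi * real n * ?x)) * cis (2 * pi * ?x)"
            unfolding sum_distrib_right mult.assoc cis_mult
            by (intro sum.cong refl) (simp add: algebra_simps add_divide_distrib)
          then have "cmod (\<Sum>n<L. b n * cis (2 * pi * real (Suc n) * ?x)) =
              cmod (\<Sum>n<L. b n * cis (2 * pi * real n * ?x))"
            by (simp add: norm_mult)
          then show "cmod (\<Sum>n<L. b n * cis (2 * pi * real n * ?x)) \<le> sqrt (C / y ^ k) + \<epsilon> L"
            using approx[where x = ?x and L = L] by simp
        qed auto
        finally show ?case using L by simp
      qed
    qed auto
    also have "\<dots> = C / y ^ k" using C(1) y by simp
    finally show ?thesis by (simp only: nb)
  qed
  show ?thesis
  \<comment> \<open>At height 1/N the squared weight exp(-4 pi (n + 1) / N) is at least exp(-4 pi)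
    for n < N.\<close>
  proof (rule that[of "C * exp (4 * pi)"])
    fix N :: nat
    show "(\<Sum>n<N. (cmod (\<alpha> n))\<^sup>2) \<le> C * exp (4 * pi) * real N ^ k"
    proof (cases "N = 0")
      case False
      have "(\<Sum>n<N. (cmod (\<alpha> n))\<^sup>2) \<le>
          (\<Sum>n<N. exp (4 * pi) * (cmod (\<alpha> n) * exp (- (2 * pi * real (Suc n) * (1 / real N))))\<^sup>2)"
      proof (intro sum_mono)
        fix n assume "n \<in> {..<N}"
        then have "real (Suc n) / real N \<le> 1" using False by (simp add: divide_simps)
        then have "0 \<le> 4 * pi * (1 - real (Suc n) / real N)" by (intro mult_nonneg_nonneg) auto
        then have "1 \<le> exp (4 * pi + - (2 * pi * real (Suc n) * (1 / real N)) * 2)"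
          by (simp add: algebra_simps add_divide_distrib)
        then have "1 \<le> exp (4 * pi) * (exp (- (2 * pi * real (Suc n) * (1 / real N))))\<^sup>2"
          by (simp only: exp_add exp_double[symmetric] mult.commute[of _ "2::real"])
        then have "(cmod (\<alpha> n))\<^sup>2 * 1 \<le>
            (cmod (\<alpha> n))\<^sup>2 * (exp (4 * pi) * (exp (- (2 * pi * real (Suc n) * (1 / real N))))\<^sup>2)"
          by (intro mult_left_mono) auto
        then show "(cmod (\<alpha> n))\<^sup>2 \<le>
          exp (4 * pi) * (cmod (\<alpha> n) * exp (- (2 * pi * real (Suc n) * (1 / real N))))\<^sup>2"
          by (simp add: power_mult_distrib mult_ac)
      qed
      also have "\<dots> \<le> exp (4 * pi) * (C / (1 / real N) ^ k)"
        unfolding sum_distrib_left[symmetric] using False by (intro mult_left_mono main) auto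
      also have "\<dots> = C * exp (4 * pi) * real N ^ k"
        by (simp add: power_divide)
      finally show ?thesis .
    qed (use C in \<open>simp add: k_pos\<close>)
  qed (use C in auto)
qed

lemma summable_coeff_sq:
  assumes "s > real k"
  shows "summable (\<lambda>n. (cmod (\<alpha> n))\<^sup>2 * real (Suc n) powr (- s))"
proof -
  obtain C where C: "C > 0" "\<And>N. (\<Sum>n<N. (cmod (\<alpha> n))\<^sup>2) \<le> C * real N ^ k"
    using rankin_bound by blast
  show ?thesis
  proof (rule summable_weight_powr[where C = C and p = "real k"])
    fix N
    show "(\<Sum>n<N. (cmod (\<alpha> n))\<^sup>2) \<le> C * real N powr real k"
      using C(2)[of N] k_pos by (cases "N = 0") (auto simp: powr_realpow)
  qed (use assms k_pos in auto)
qed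

text \<open>Cauchy-Schwarz against the constant 1 bounds the first moments by N^((k+1)/2). The
  threshold lies 1/4 below the exponent (k+1)/2 + 1/4 of the series in J_{k+1}; this margin pays for
  its absolute convergence and for the decay of its tail.\<close>

lemma summable_coeff:
  assumes "s > (real k + 1) / 2"
  shows "summable (\<lambda>n. cmod (\<alpha> n) * real (Suc n) powr (- s))"
proof -
  obtain C where C: "C > 0" "\<And>N. (\<Sum>n<N. (cmod (\<alpha> n))\<^sup>2) \<le> C * real N ^ k"
    using rankin_bound by blast
  show ?thesis
  proof (rule summable_weight_powr[where C = "sqrt C" and p = "(real k + 1) / 2"])
    fix N
    show "(\<Sum>n<N. cmod (\<alpha> n)) \<le> sqrt C * real N powr ((real k + 1) / 2)"
    proof (cases "N = 0")
      case False
      have "(\<Sum>n<N. cmod (\<alpha> n) * 1)\<^sup>2 \<le> (\<Sum>n<N. (cmod (\<alpha> n))\<^sup>2) * (\<Sum>n<N. 1\<^sup>2)"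
        by (rule Cauchy_Schwarz_ineq_sum)
      also have "\<dots> \<le> (C * real N ^ k) * real N"
        using C(2)[of N] by (simp add: mult_right_mono)
      also have "\<dots> = (sqrt C * real N powr ((real k + 1) / 2))\<^sup>2"
      proof -
        have "(real N powr ((real k + 1) / 2))\<^sup>2 = real N powr (real (Suc k))"
          unfolding power2_eq_square powr_add[symmetric] by (rule arg_cong2[where f = "(powr)"]) simp_all
        also have "\<dots> = real N ^ Suc k"
          using False by (subst powr_realpow) auto
        finally show ?thesis using C(1) by (simp add: power_mult_distrib)
      qed
      finally have "(\<Sum>n<N. cmod (\<alpha> n))\<^sup>2 \<le> (sqrt C * real N powr ((real k + 1) / 2))\<^sup>2"
        by simp
      then show ?thesis
        by (rule power2_le_imp_le) (use C(1) in simp)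
    qed simp
  qed (use assms k_pos in auto)
qed

end

section \<open>The Voronoi formula\<close>

text \<open>Integrability and value in one predicate, on the whole line with an indicator, so that
  the rules for \<open>has_bochner_integral\<close> apply directly; Banach-space values cover real
  and complex functions alike.\<close>

definition has_laplace ::
  "(real \<Rightarrow> 'a::{banach,second_countable_topology}) \<Rightarrow> real \<Rightarrow> 'a \<Rightarrow> bool" where
  "has_laplace g s L \<longleftrightarrow>
     has_bochner_integral lborel (\<lambda>x. indicator {0..} x *\<^sub>R (exp (- (s * x)) *\<^sub>R g x)) L"

section \<open>Rules, basic transforms and uniqueness\<close>

lemma has_laplace_linear:
  assumes "bounded_linear T" "has_laplace g s L"
  shows "has_laplace (\<lambda>x. T (g x)) s (T L)"
  using has_bochner_integral_bounded_linear[OF assms(1) assms(2)[unfolded has_laplace_def]]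
  by (simp add: has_laplace_def linear_cmul[OF bounded_linear.linear[OF assms(1)]])

lemma has_laplace_diff:
  assumes "has_laplace g s L" "has_laplace h s M"
  shows "has_laplace (\<lambda>x. g x - h x) s (L - M)"
  using has_bochner_integral_diff[OF assms[unfolded has_laplace_def]]
  by (simp add: has_laplace_def scaleR_right_diff_distrib)

lemma has_laplace_add:
  assumes "has_laplace g s L" "has_laplace h s M"
  shows "has_laplace (\<lambda>x. g x + h x) s (L + M)"
  using has_bochner_integral_add[OF assms[unfolded has_laplace_def]]
  by (simp add: has_laplace_def scaleR_right_distrib)

text \<open>The integrand is a multiple of the Erlang density, whose moment of order 0 supplies the
  Gamma integral.\<close>

lemma has_laplace_power:
  assumes s: "s > 0"
  shows "has_laplace (\<lambda>x. x ^ n) s (fact n / s ^ Suc n)"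
proof -
  have "has_bochner_integral lborel (\<lambda>x. fact n / s ^ Suc n * (erlang_density n s x * x ^ 0))
      (fact n / s ^ Suc n * (fact (n + 0) / (fact n * s ^ 0)))"
    using nn_integral_erlang_ith_moment[OF s, of n 0] s
    by (intro has_bochner_integral_mult_right has_bochner_integral_nn_integral) auto
  moreover have "fact n / s ^ Suc n * (erlang_density n s x * x ^ 0) =
      indicator {0..} x *\<^sub>R (exp (- (s * x)) *\<^sub>R x ^ n)" for x
    using s by (auto simp: erlang_density_def indicator_def)
  ultimately show ?thesis
    by (simp add: has_laplace_def)
qed

lemma has_laplace_ramp:
  assumes s: "s > 0" and m: "m \<ge> 0"
  shows "has_laplace (\<lambda>x. max 0 (x - m)) s (exp (- (s * m)) / s\<^sup>2)"
proof -
  let ?f = "\<lambda>x::real. indicator {0..} x *\<^sub>R (exp (- (s * x)) *\<^sub>R x ^ 1)"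
  have "has_bochner_integral lborel ?f (fact 1 / s ^ Suc 1)"
    using has_laplace_power[OF s, of 1] unfolding has_laplace_def .
  then have "has_bochner_integral lborel (\<lambda>x. ?f (- m + 1 * x)) ((fact 1 / s ^ Suc 1) /\<^sub>R \<bar>1\<bar>)"
    by (subst lborel_has_bochner_integral_real_affine_iff[symmetric]) auto
  then have "has_bochner_integral lborel (\<lambda>x. exp (- (s * m)) * ?f (- m + 1 * x))
      (exp (- (s * m)) * ((fact 1 / s ^ Suc 1) /\<^sub>R \<bar>1\<bar>))"
    by (rule has_bochner_integral_mult_right) 
  moreover have "exp (- (s * m)) * ?f (- m + 1 * x) =
      indicator {0..} x *\<^sub>R (exp (- (s * x)) *\<^sub>R max 0 (x - m))" for x
  proof (cases "m \<le> x")
    case True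
    have "exp (- (s * m)) * exp (- (s * (x - m))) = exp (- (s * x))"
      by (simp add: exp_add[symmetric] right_diff_distrib)
    moreover have "- m + 1 * x = x - m" by simp
    ultimately show ?thesis
      using True m by (simp add: mult.assoc[symmetric])
  qed (auto simp: indicator_def max_def)
  ultimately show ?thesis
    by (simp add: has_laplace_def power2_eq_square)
qed

text \<open>Dominating each term by some \<open>h n\<close> of known transform reduces the exchange
  of sum and integral to the summability of the numbers \<open>B n\<close>.\<close>

lemma has_laplace_suminf:
  fixes g :: "nat \<Rightarrow> real \<Rightarrow> 'a::{banach,second_countable_topology}"
  assumes g: "\<And>n. has_laplace (g n) s (L n)"
    and h: "\<And>n. has_laplace (h n) s (B n)"
    and gh: "\<And>n x. x \<ge> 0 \<Longrightarrow> norm (g n x) \<le> h n x"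
    and B: "summable B"
    and sm: "\<And>x. x \<ge> 0 \<Longrightarrow> summable (\<lambda>n. norm (g n x))"
  shows "has_laplace (\<lambda>x. \<Sum>n. g n x) s (\<Sum>n. L n)"
proof -
  let ?W = "\<lambda>x v. indicator {0..} x *\<^sub>R (exp (- (s * x)) *\<^sub>R v)"
  have ig: "integrable lborel (\<lambda>x. ?W x (g n x))" "integral\<^sup>L lborel (\<lambda>x. ?W x (g n x)) = L n" for n
    using g[of n] by (auto simp: has_laplace_def has_bochner_integral_iff)
  have ih: "integrable lborel (\<lambda>x. ?W x (h n x))" "integral\<^sup>L lborel (\<lambda>x. ?W x (h n x)) = B n" for n
    using h[of n] by (auto simp: has_laplace_def has_bochner_integral_iff)
  have le: "norm (?W x (g n x)) \<le> ?W x (h n x)" for n x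
    using gh[of x n] by (auto simp: indicator_def)
  have "(\<integral>x. norm (?W x (g n x)) \<partial>lborel) \<le> B n" for n
    unfolding ih(2)[symmetric] by (intro integral_mono le ih(1) integrable_norm ig(1))
  then have s3: "summable (\<lambda>n. \<integral>x. norm (?W x (g n x)) \<partial>lborel)"
    by (intro summable_comparison_test'[OF B]) (simp add: integral_nonneg_AE)
  have "summable (\<lambda>n. norm (?W x (g n x)))" for x
    using summable_mult[OF sm, of x "exp (- (s * x))"] by (auto simp: indicator_def)
  then have s2: "AE x in lborel. summable (\<lambda>n. norm (?W x (g n x)))"
    by simp
  note * = integrable_suminf[OF ig(1) s2 s3] sums_integral[OF ig(1) s2 s3]
  have eq: "(\<Sum>n. ?W x (g n x)) = ?W x (\<Sum>n. g n x)" for x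
  proof (cases "x \<ge> 0")
    case True
    then show ?thesis
      using suminf_scaleR_right[OF summable_norm_cancel[OF sm[OF True]], of "exp (- (s * x))"]
      by (simp add: indicator_def)
  qed (simp add: indicator_def)
  show ?thesis
    using * unfolding has_laplace_def has_bochner_integral_iff eq ig(2) by (auto simp: sums_iff)
qed

lemma continuous_on_suminf_atLeast:
  fixes g :: "nat \<Rightarrow> real \<Rightarrow> 'a::banach"
  assumes c: "\<And>n. continuous_on {0..} (g n)"
    and m: "\<And>b. \<exists>B. summable B \<and> (\<forall>n. \<forall>x\<in>{0..b}. norm (g n x) \<le> B n)"
  shows "continuous_on {0..} (\<lambda>x. \<Sum>n. g n x)"
  unfolding continuous_on_eq_continuous_within
proof
  fix x :: real assume x: "x \<in> {0..}"
  obtain B where B: "summable B" "\<And>n y. y \<in> {0..x + 1} \<Longrightarrow> norm (g n y) \<le> B n"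
    using m[of "x + 1"] by blast
  have "uniform_limit {0..x + 1} (\<lambda>n y. \<Sum>i<n. g i y) (\<lambda>y. \<Sum>i. g i y) sequentially"
    by (rule Weierstrass_m_test[OF B(2) B(1)])
  then have "continuous_on {0..x + 1} (\<lambda>y. \<Sum>i. g i y)"
    by (rule uniform_limit_theorem[rotated])
       (auto intro!: always_eventually continuous_on_sum continuous_on_subset[OF c])
  then have "continuous (at x within {0..x + 1}) (\<lambda>y. \<Sum>i. g i y)"
    using x by (auto simp: continuous_on_eq_continuous_within)
  moreover have "at x within {0..x + 1} = at x within {0..}"
    by (rule at_within_nhd[of _ "{..<x + 1}"]) auto
  ultimately show "continuous (at x within {0..}) (\<lambda>y. \<Sum>i. g i y)"
    by (simp add: continuous_within)
qed

text \<open>Lerch's theorem: after the substitution \<open>u = exp (- x)\<close> the hypothesis says that all moments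
  vanish, so Weierstrass approximation applies.\<close>

lemma laplace_zero_imp_zero:
  fixes G :: "real \<Rightarrow> real"
  assumes cont: "continuous_on {0..} G"
    and bound: "\<And>x. x \<ge> 0 \<Longrightarrow> \<bar>G x\<bar> \<le> C * exp (x / 2)"
    and zero: "\<And>n. has_laplace G (real (Suc n)) 0"
    and x: "x \<ge> 0"
  shows "G x = 0"
proof -
  \<comment> \<open>One factor u = exp(- x) of the kernel stays with \<open>G\<close>: against the
    growth exp(x/2) it leaves O(sqrt u), which makes \<open>\<gamma>\<close> continuous at 0 with
    value 0.\<close>
  define \<gamma> where "\<gamma> u = u * G (- ln u)" for u
  define T where "T x = indicator {0..} x * (exp (- x) * G x)" for x :: real
  have C0: "C \<ge> 0" using order_trans[OF abs_ge_zero bound[of 0]] by simp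
  have "continuous_on {0..1} \<gamma>"
    unfolding continuous_on_eq_continuous_within
  proof
    fix u :: real assume u: "u \<in> {0..1}"
    show "continuous (at u within {0..1}) \<gamma>"
    proof (cases "u = 0")
      case True
      have "((\<lambda>u. C * sqrt u) \<longlongrightarrow> C * sqrt 0) (at 0 within {0..1})"
        by (intro tendsto_intros)
      then have lim: "((\<lambda>u. C * sqrt u) \<longlongrightarrow> 0) (at 0 within {0..1})" by simp
      have "(\<gamma> \<longlongrightarrow> 0) (at 0 within {0..1})"
      proof (rule Lim_null_comparison[OF _ lim])
        show "\<forall>\<^sub>F u in at 0 within {0..1}. norm (\<gamma> u) \<le> C * sqrt u"
          unfolding eventually_at_filter
        proof (intro always_eventually allI impI)
          fix u :: real assume u: "u \<noteq> 0" "u \<in> {0..1}"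
          have su: "sqrt u * sqrt u = u" "sqrt u > 0" using u by auto
          have "exp (- ln u / 2) = inverse (sqrt u)"
            using u by (simp add: ln_sqrt[symmetric] exp_minus)
          then have "\<bar>G (- ln u)\<bar> \<le> C * inverse (sqrt u)"
            using bound[of "- ln u"] u by simp
          then have "u * \<bar>G (- ln u)\<bar> \<le> u * (C * inverse (sqrt u))"
            using u by (intro mult_left_mono) auto
          also have "\<dots> = C * sqrt u"
            using su by (simp add: field_simps)
          finally show "norm (\<gamma> u) \<le> C * sqrt u"
            using u by (simp add: \<gamma>_def abs_mult)
        qed
      qed
      then show ?thesis using True by (simp add: continuous_within \<gamma>_def)
    next
      case False
      have "continuous_on {0<..1} \<gamma>"
        unfolding \<gamma>_def by (intro continuous_intros continuous_on_compose2[OF cont]) auto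
      then have "continuous (at u within {0<..1}) \<gamma>"
        using u False by (auto simp: continuous_on_eq_continuous_within)
      moreover have "at u within {0<..1} = at u within {0..1}"
        by (rule at_within_nhd[of _ "{0<..}"]) (use u False in auto)
      ultimately show ?thesis by simp
    qed
  qed
  have T: "integrable lborel T"
    using zero[of 0] by (simp add: has_laplace_def has_bochner_integral_iff T_def[abs_def])
  have T_le: "\<bar>T y\<bar> \<le> C" for y
  proof (cases "y \<ge> 0")
    case True
    have "exp (- y) * \<bar>G y\<bar> \<le> exp (- y) * (C * exp (y / 2))"
      by (intro mult_left_mono bound True) auto
    also have "\<dots> = C * exp (- y / 2)" by (simp add: exp_add[symmetric])
    also have "\<dots> \<le> C" using C0 True by (simp add: mult_left_le)
    finally show ?thesis using True by (simp add: T_def abs_mult)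
  qed (use C0 in \<open>simp add: T_def\<close>)
  have T2: "integrable lborel (\<lambda>x. T x * T x)"
  proof (rule Bochner_Integration.integrable_bound[where f = "\<lambda>x. C * T x"])
    show "AE x in lborel. norm (T x * T x) \<le> norm (C * T x)"
    proof (rule AE_I2)
      fix x
      show "norm (T x * T x) \<le> norm (C * T x)"
        using mult_right_mono[OF T_le[of x] abs_ge_zero[of "T x"]] C0 by (simp add: abs_mult)
    qed
  qed (use T in auto)
  have small: "(\<integral>x. T x * T x \<partial>lborel) \<le> e * (\<integral>x. \<bar>T x\<bar> \<partial>lborel)" if e: "e > 0" for e
  proof -
    obtain p where p: "real_polynomial_function p" "\<And>u. u \<in> {0..1} \<Longrightarrow> \<bar>\<gamma> u - p u\<bar> < e"
      by (rule Stone_Weierstrass_real_polynomial_function[OF compact_Icc \<open>continuous_on {0..1} \<gamma>\<close> e])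
         (rule that, assumption, blast)
    obtain c n where cn: "p = (\<lambda>x. \<Sum>i\<le>n. c i * x ^ i)"
      using p(1) real_polynomial_function_iff_sum by metis
    have "has_bochner_integral lborel (\<lambda>x. \<Sum>i\<le>n. c i *
        (indicator {0..} x *\<^sub>R (exp (- (real (Suc i) * x)) *\<^sub>R G x))) (\<Sum>i\<le>n. c i * 0)"
      using zero unfolding has_laplace_def
      by (intro has_bochner_integral_sum has_bochner_integral_mult_right) auto
    moreover have "(\<Sum>i\<le>n. c i * (indicator {0..} x *\<^sub>R (exp (- (real (Suc i) * x)) *\<^sub>R G x))) =
        T x * p (exp (- x))" for x
    proof -
      have "exp (- (real (Suc i) * x)) = exp (- x) * exp (- x) ^ i" for i
        by (simp add: exp_of_nat_mult[symmetric] exp_add[symmetric] algebra_simps)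
      then show ?thesis
        unfolding cn T_def by (simp add: sum_distrib_left mult_ac)
    qed
    ultimately have Tp: "integrable lborel (\<lambda>x. T x * p (exp (- x)))"
       "(\<integral>x. T x * p (exp (- x)) \<partial>lborel) = 0"
      by (simp_all add: has_bochner_integral_iff)
    have "(\<integral>x. T x * T x \<partial>lborel) = (\<integral>x. T x * T x - T x * p (exp (- x)) \<partial>lborel)"
      by (simp add: Bochner_Integration.integral_diff[OF T2 Tp(1)] Tp(2))
    also have "\<dots> \<le> (\<integral>x. e * \<bar>T x\<bar> \<partial>lborel)"
    proof (rule integral_mono)
      fix x
      show "T x * T x - T x * p (exp (- x)) \<le> e * \<bar>T x\<bar>"
      proof (cases "x \<ge> 0")
        case True
        have "T x = \<gamma> (exp (- x))" using True by (simp add: T_def \<gamma>_def)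
        then have "\<bar>T x - p (exp (- x))\<bar> \<le> e"
          using p(2)[of "exp (- x)"] True by simp
        then have "\<bar>T x\<bar> * \<bar>T x - p (exp (- x))\<bar> \<le> \<bar>T x\<bar> * e"
          by (intro mult_left_mono) auto
        moreover have "T x * (T x - p (exp (- x))) \<le> \<bar>T x\<bar> * \<bar>T x - p (exp (- x))\<bar>"
          unfolding abs_mult[symmetric] by (rule abs_ge_self)
        ultimately show ?thesis by (simp add: algebra_simps)
      qed (simp add: T_def)
    qed (use T T2 Tp(1) in auto)
    finally show ?thesis by simp
  qed
  have nonpos: "(\<integral>x. T x * T x \<partial>lborel) \<le> 0"
  proof (rule field_le_epsilon)
    fix e :: real assume e: "e > 0"
    define I where "I = (\<integral>x. \<bar>T x\<bar> \<partial>lborel)"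
    have I: "I \<ge> 0" unfolding I_def by (intro integral_nonneg_AE) auto
    have "(\<integral>x. T x * T x \<partial>lborel) \<le> e / (I + 1) * I"
      unfolding I_def by (rule small) (use e I in \<open>simp add: I_def add_nonneg_pos\<close>)
    also have "\<dots> \<le> e" using e I by (simp add: field_simps)
    finally show "(\<integral>x. T x * T x \<partial>lborel) \<le> 0 + e" by simp
  qed
  \<comment> \<open>From an integral back to a value: a continuous square with integral 0 over a
    compact interval vanishes on it. The end point x + 1 keeps the interval nondegenerate when x =
    0.\<close>
  have "set_integrable lborel {0..x + 1} (\<lambda>x. T x * T x)"
    unfolding set_integrable_def using T2 by (intro integrable_mult_indicator) auto
  note * = set_borel_integral_eq_integral[OF this]
  have "(LINT y:{0..x + 1}|lborel. T y * T y) \<le> (\<integral>x. T x * T x \<partial>lborel)"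
    unfolding set_lebesgue_integral_def
    by (intro integral_mono T2 integrable_mult_indicator) (auto simp: indicator_def)
  then have "integral {0..x + 1} (\<lambda>y. T y * T y) \<le> 0"
    using *(2) nonpos by simp
  moreover have "integral {0..x + 1} (\<lambda>y. T y * T y) \<ge> 0"
    by (intro integral_nonneg *(1)) auto
  moreover have "integral {0..x + 1} (\<lambda>y. T y * T y) = integral {0..x + 1} (\<lambda>y. (exp (- y) * G y)\<^sup>2)"
    by (rule integral_cong) (simp add: T_def power2_eq_square)
  ultimately have "integral {0..x + 1} (\<lambda>y. (exp (- y) * G y)\<^sup>2) = 0"
    by simp
  then have "\<forall>y\<in>{0..x + 1}. (exp (- y) * G y)\<^sup>2 = 0"
    by (subst (asm) integral_eq_0_iff)
       (use x in \<open>auto intro!: continuous_intros continuous_on_subset[OF cont]\<close>)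
  then show ?thesis using x by simp
qed

text \<open>The transform of x^(j+v) contributes (j+v)!, which cancels that factorial in the
  coefficient and leaves the exponential series in -l/s. The appearance of 1/s is what lets modular
  inversion act.\<close>

lemma has_laplace_bessel_clifford:
  assumes s: "s > 0" and l: "l \<ge> 0"
  shows "has_laplace (\<lambda>x. x ^ v * bessel_clifford v (l * x)) s (exp (- (l / s)) / s ^ Suc v)"
proof -
  define c where "c j = (-1) ^ j / (fact j * fact (j + v)) * l ^ j" for j
  let ?g = "\<lambda>j x. c j * x ^ (j + v)"
  have e: "(\<lambda>j. (- (l / s)) ^ j /\<^sub>R fact j) sums exp (- (l / s))"
    by (rule exp_converges)
  have Lj: "c j * (fact (j + v) / s ^ Suc (j + v)) = (- (l / s)) ^ j /\<^sub>R fact j / s ^ Suc v" for j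
    using s by (simp add: c_def power_minus[of "l / s"] power_divide power_add field_simps)
  have "has_laplace (\<lambda>x. \<Sum>j. ?g j x) s (\<Sum>j. c j * (fact (j + v) / s ^ Suc (j + v)))"
  proof (rule has_laplace_suminf)
    show "has_laplace (?g j) s (c j * (fact (j + v) / s ^ Suc (j + v)))" for j
      by (intro has_laplace_linear[OF bounded_linear_mult_right] has_laplace_power s)
    show "has_laplace (\<lambda>x. \<bar>c j\<bar> * x ^ (j + v)) s (\<bar>c j\<bar> * (fact (j + v) / s ^ Suc (j + v)))" for j
      by (intro has_laplace_linear[OF bounded_linear_mult_right] has_laplace_power s)
    show "summable (\<lambda>j. \<bar>c j\<bar> * (fact (j + v) / s ^ Suc (j + v)))"
    proof -
      have "\<bar>c j\<bar> * (fact (j + v) / s ^ Suc (j + v)) = (l / s) ^ j /\<^sub>R fact j * (1 / s ^ Suc v)" for j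
        using s l by (simp add: c_def abs_mult power_divide power_add field_simps)
      then show ?thesis
        using summable_mult2[OF summable_exp_generic[of "l / s"], of "1 / s ^ Suc v"] by simp
    qed
    show "summable (\<lambda>j. norm (c j * x ^ (j + v)))" for x
    proof -
      have "norm (c j * x ^ (j + v)) =
          \<bar>(-1) ^ j / (fact j * fact (j + v)) * (l * x) ^ j\<bar> * \<bar>x\<bar> ^ v" for j
        by (simp add: c_def abs_mult power_mult_distrib power_add power_abs)
      then show ?thesis
        using summable_mult2[OF bessel_clifford_abs_summable[of v "l * x"], of "\<bar>x\<bar> ^ v"] by simp
    qed
  qed (simp add: abs_mult)
  moreover have "(\<Sum>j. ?g j x) = x ^ v * bessel_clifford v (l * x)" for x
    unfolding bessel_clifford_def suminf_mult[OF bessel_clifford_summable, symmetric]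
    by (rule suminf_cong) (simp add: c_def power_mult_distrib power_add)
  moreover have "(\<Sum>j. c j * (fact (j + v) / s ^ Suc (j + v))) = exp (- (l / s)) / s ^ Suc v"
    unfolding Lj using sums_divide[OF e, of "s ^ Suc v"] by (simp add: sums_iff)
  ultimately show ?thesis by simp
qed

lemma power_bessel_clifford_bound:
  assumes "v > 0"
  obtains C where "C > 0"
    "\<And>l x. l > 0 \<Longrightarrow> x \<ge> 0 \<Longrightarrow>
      \<bar>x ^ v * bessel_clifford v (l * x)\<bar> \<le> C * x powr (real v / 2 - 1/4) * l powr (- (real v / 2 + 1/4))"
proof -
  obtain C where C: "C > 0"
    "\<And>x. x > 0 \<Longrightarrow> \<bar>bessel_clifford v x\<bar> \<le> C * x powr (- (real v / 2 + 1/4))"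
    using bessel_clifford_bound[of v] by metis
  show ?thesis
  proof (rule that[OF C(1)])
    fix l x :: real assume lx: "l > 0" "x \<ge> 0"
    show "\<bar>x ^ v * bessel_clifford v (l * x)\<bar> \<le> C * x powr (real v / 2 - 1/4) * l powr (- (real v / 2 + 1/4))"
    proof (cases "x = 0")
      case True
      then show ?thesis using assms C(1) by simp
    next
      case False
      with lx have x: "x > 0" by simp
      have "\<bar>x ^ v * bessel_clifford v (l * x)\<bar> \<le> x ^ v * (C * (l * x) powr (- (real v / 2 + 1/4)))"
        using x lx C(2)[of "l * x"] by (simp add: abs_mult)
      also have "\<dots> = C * (x powr real v * x powr (- (real v / 2 + 1/4))) * l powr (- (real v / 2 + 1/4))"
        using x lx by (simp add: powr_mult powr_realpow)
      also have "x powr real v * x powr (- (real v / 2 + 1/4)) = x powr (real v / 2 - 1/4)"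
        by (simp add: powr_add[symmetric])
      finally show ?thesis .
    qed
  qed
qed

section \<open>The Riesz mean and its Voronoi series\<close>

context cusp_expansion
begin

definition riesz_term :: "nat \<Rightarrow> real \<Rightarrow> complex" where
  "riesz_term n x = \<alpha> n * of_real (max 0 (x - real (Suc n)))"

definition voronoi_term :: "nat \<Rightarrow> real \<Rightarrow> complex" where
  "voronoi_term n x = \<alpha> n * of_real (x ^ Suc k * bessel_clifford (Suc k) (4 * pi\<^sup>2 * real (Suc n) * x))"

text \<open>Where the term is nonzero, n + 1 \<le> x, hence x/4 \<le> x/2 - (n+1)/4. This separates
  a summable weight in n from the growth exp(x/2) that \<open>laplace_zero_imp_zero\<close>
  tolerates.\<close>

lemma norm_riesz_term_le:
  assumes "x \<ge> 0"
  shows "norm (riesz_term n x) \<le> cmod (\<alpha> n) * exp (- (real (Suc n) / 4)) * (4 * exp (x / 2))"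
proof (cases "real (Suc n) \<le> x")
  case True
  have "x - real (Suc n) \<le> 4 * exp (x / 4)"
    using exp_ge_add_one_self[of "x / 4"] by (simp add: field_simps)
  also have "\<dots> \<le> exp (- (real (Suc n) / 4)) * (4 * exp (x / 2))"
  proof -
    have "exp (x / 4) \<le> exp (- (real (Suc n) / 4) + x / 2)"
      using True unfolding exp_le_cancel_iff by (simp add: field_simps)
    then show ?thesis unfolding exp_add by simp
  qed
  finally have "cmod (\<alpha> n) * (x - real (Suc n)) \<le>
      cmod (\<alpha> n) * (exp (- (real (Suc n) / 4)) * (4 * exp (x / 2)))"
    by (intro mult_left_mono) auto
  then show ?thesis
    using True by (simp add: riesz_term_def norm_mult mult.assoc del: of_real_diff of_nat_Suc)
qed (auto simp: riesz_term_def max_def)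

lemma summable_quarter: "summable (\<lambda>n. cmod (\<alpha> n) * exp (- (real (Suc n) / 4)))"
proof -
  have "2 * pi * real (Suc n) * (1 / (8 * pi)) = real (Suc n) / 4" for n
    by (simp del: of_nat_Suc)
  then show ?thesis
    using abs_summable[of "1 / (8 * pi)"] by (simp del: of_nat_Suc)
qed

lemma has_laplace_riesz:
  assumes s: "s > 0"
  shows "has_laplace (\<lambda>x. \<Sum>n. riesz_term n x) s (f (\<i> * of_real (s / (2 * pi))) / of_real (s\<^sup>2))"
proof -
  let ?L = "\<lambda>n. \<alpha> n * of_real (exp (- (s * real (Suc n))) / s\<^sup>2)"
  have "has_laplace (\<lambda>x. \<Sum>n. riesz_term n x) s (\<Sum>n. ?L n)"
  proof (rule has_laplace_suminf)
    show "has_laplace (riesz_term n) s (?L n)" for n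
      unfolding riesz_term_def[abs_def]
      by (intro has_laplace_linear[OF bounded_linear_mult_right]
          has_laplace_linear[OF bounded_linear_of_real] has_laplace_ramp s) simp
    show "has_laplace (\<lambda>x. cmod (\<alpha> n) * max 0 (x - real (Suc n))) s
        (cmod (\<alpha> n) * (exp (- (s * real (Suc n))) / s\<^sup>2))" for n
      by (intro has_laplace_linear[OF bounded_linear_mult_right] has_laplace_ramp s) simp
    show "summable (\<lambda>n. cmod (\<alpha> n) * (exp (- (s * real (Suc n))) / s\<^sup>2))"
      using summable_divide[OF abs_summable[of "s / (2 * pi)"], of "s\<^sup>2"] s
      by (simp add: mult.commute del: of_nat_Suc)
    show "summable (\<lambda>n. norm (riesz_term n x))" if "x \<ge> 0" for x
      by (rule summable_comparison_test'[OF summable_mult2[OF summable_quarter]])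
         (use norm_riesz_term_le[OF that] in simp)
  qed (simp add: riesz_term_def norm_mult)
  moreover have "?L sums (f (\<i> * of_real (s / (2 * pi))) / of_real (s\<^sup>2))"
  proof -
    have "(\<lambda>n. \<alpha> n * exp (2 * of_real pi * \<i> * of_nat (Suc n) * (\<i> * of_real (s / (2 * pi))))) sums
        f (\<i> * of_real (s / (2 * pi)))"
      by (rule expansion) (use s in simp)
    moreover have "2 * of_real pi * \<i> * of_nat (Suc n) * (\<i> * of_real (s / (2 * pi))) =
        complex_of_real (- (s * real (Suc n)))" for n
      by (simp add: complex_eq_iff)
    ultimately have "(\<lambda>n. \<alpha> n * of_real (exp (- (s * real (Suc n))))) sums f (\<i> * of_real (s / (2 * pi)))"
      by (simp only: exp_of_real)
    from sums_divide[OF this, of "of_real (s\<^sup>2)"] show ?thesis by simp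
  qed
  ultimately show ?thesis by (simp add: sums_iff)
qed

lemma norm_voronoi_term_le:
  obtains C where "C > 0" "\<And>n x. x \<ge> 0 \<Longrightarrow> norm (voronoi_term n x) \<le>
    C * x powr (real (Suc k) / 2 - 1/4) * (cmod (\<alpha> n) * real (Suc n) powr (- (real (Suc k) / 2 + 1/4)))"
proof -
  let ?p = "- (real (Suc k) / 2 + 1/4)"
  obtain C where C: "C > 0"
    "\<And>l x. l > 0 \<Longrightarrow> x \<ge> 0 \<Longrightarrow>
      \<bar>x ^ Suc k * bessel_clifford (Suc k) (l * x)\<bar> \<le> C * x powr (real (Suc k) / 2 - 1/4) * l powr ?p"
    by (rule power_bessel_clifford_bound[OF zero_less_Suc[of k]]) (rule that, assumption, blast)
  show ?thesis
  proof (rule that[of "C * (4 * pi\<^sup>2) powr ?p"])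
    show "C * (4 * pi\<^sup>2) powr ?p > 0" using C(1) by simp
    fix n and x :: real assume x: "x \<ge> 0"
    have pos: "4 * pi\<^sup>2 * real (Suc n) > 0" by simp
    have m: "(4 * pi\<^sup>2 * real (Suc n)) powr ?p = (4 * pi\<^sup>2) powr ?p * real (Suc n) powr ?p"
      by (rule powr_mult)
    have "norm (voronoi_term n x) = cmod (\<alpha> n) *
        \<bar>x ^ Suc k * bessel_clifford (Suc k) (4 * pi\<^sup>2 * real (Suc n) * x)\<bar>"
      unfolding voronoi_term_def norm_mult norm_of_real ..
    also have "\<dots> \<le> cmod (\<alpha> n) *
        (C * x powr (real (Suc k) / 2 - 1/4) * (4 * pi\<^sup>2 * real (Suc n)) powr ?p)"
      by (intro mult_left_mono C(2)[OF pos x]) auto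
    finally show "norm (voronoi_term n x) \<le> C * (4 * pi\<^sup>2) powr ?p * x powr (real (Suc k) / 2 - 1/4) *
        (cmod (\<alpha> n) * real (Suc n) powr ?p)"
      unfolding m by (simp only: mult_ac)
  qed
qed

lemma summable_voronoi_weight:
  "summable (\<lambda>n. cmod (\<alpha> n) * real (Suc n) powr (- (real (Suc k) / 2 + 1/4)))"
  by (rule summable_coeff) (simp add: field_simps)

lemma powr_le_one_plus_power:
  assumes "x \<ge> (0::real)"
  shows "x powr (real (Suc k) / 2 - 1/4) \<le> 1 + x ^ Suc k"
proof (cases "x \<ge> 1")
  case True
  have "x powr (real (Suc k) / 2 - 1/4) \<le> x powr real (Suc k)"
    using True by (intro powr_mono) (auto simp: field_simps)
  also have "\<dots> = x ^ Suc k" using True by (intro powr_realpow) auto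
  finally show ?thesis by simp
next
  case False
  have "x powr (real (Suc k) / 2 - 1/4) \<le> 1 powr (real (Suc k) / 2 - 1/4)"
    using assms False k_pos by (intro powr_mono2) auto
  then show ?thesis using zero_le_power[OF assms, of "Suc k"] by simp
qed

text \<open>Since 4 pi^2 n / s = 2 pi n (2 pi / s), the exponentials add up to the value of f at
  height 2 pi / s, the image under z -> -1/z of the height s / (2 pi) belonging to the Riesz
  mean.\<close>

lemma has_laplace_voronoi:
  assumes s: "s > 0"
  shows "has_laplace (\<lambda>x. \<Sum>n. voronoi_term n x) s
    (f (\<i> * of_real (2 * pi / s)) / of_real (s ^ Suc (Suc k)))"
proof -
  let ?L = "\<lambda>n. \<alpha> n * of_real (exp (- (4 * pi\<^sup>2 * real (Suc n) / s)) / s ^ Suc (Suc k))"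
  let ?w = "\<lambda>n. cmod (\<alpha> n) * real (Suc n) powr (- (real (Suc k) / 2 + 1/4))"
  obtain C where C: "C > 0" "\<And>n x. x \<ge> 0 \<Longrightarrow> norm (voronoi_term n x) \<le>
    C * x powr (real (Suc k) / 2 - 1/4) * ?w n"
    by (rule norm_voronoi_term_le) (rule that, assumption, blast)
  \<comment> \<open>The fractional power of x is replaced by 1 + x^(k+1), a majorant whose transform
    is known.\<close>
  have C': "norm (voronoi_term n x) \<le> (C * ?w n) * (x ^ 0 + x ^ Suc k)" if "x \<ge> 0" for n x
  proof -
    have "C * ?w n * x powr (real (Suc k) / 2 - 1/4) \<le> (C * ?w n) * (x ^ 0 + x ^ Suc k)"
      using C(1) powr_le_one_plus_power[OF that] by (intro mult_left_mono) auto
    then show ?thesis using C(2)[OF that, of n] by (simp only: mult_ac)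
  qed
  have "has_laplace (\<lambda>x. \<Sum>n. voronoi_term n x) s (\<Sum>n. ?L n)"
  proof (rule has_laplace_suminf[OF _ _ C'])
    show "has_laplace (voronoi_term n) s (?L n)" for n
      unfolding voronoi_term_def[abs_def]
      by (intro has_laplace_linear[OF bounded_linear_mult_right]
          has_laplace_linear[OF bounded_linear_of_real] has_laplace_bessel_clifford s) simp
    show "has_laplace (\<lambda>x. (C * ?w n) * (x ^ 0 + x ^ Suc k)) s
        ((C * ?w n) * (fact 0 / s ^ Suc 0 + fact (Suc k) / s ^ Suc (Suc k)))" for n
      by (intro has_laplace_linear[OF bounded_linear_mult_right] has_laplace_add has_laplace_power s)
    show "summable (\<lambda>n. (C * ?w n) * (fact 0 / s ^ Suc 0 + fact (Suc k) / s ^ Suc (Suc k)))"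
      by (intro summable_mult2 summable_mult summable_voronoi_weight)
    show "summable (\<lambda>n. norm (voronoi_term n x))" if "x \<ge> 0" for x
      by (rule summable_comparison_test'[OF
            summable_mult2[OF summable_mult[OF summable_voronoi_weight, of C]]])
         (use C'[OF that] in simp)
  qed auto
  moreover have "?L sums (f (\<i> * of_real (2 * pi / s)) / of_real (s ^ Suc (Suc k)))"
  proof -
    have "(\<lambda>n. \<alpha> n * exp (2 * of_real pi * \<i> * of_nat (Suc n) * (\<i> * of_real (2 * pi / s)))) sums
        f (\<i> * of_real (2 * pi / s))"
      by (rule expansion) (use s in simp)
    moreover have "2 * of_real pi * \<i> * of_nat (Suc n) * (\<i> * of_real (2 * pi / s)) =
        complex_of_real (- (4 * pi\<^sup>2 * real (Suc n) / s))" for n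
      by (simp add: complex_eq_iff power2_eq_square)
    ultimately have "(\<lambda>n. \<alpha> n * of_real (exp (- (4 * pi\<^sup>2 * real (Suc n) / s)))) sums
        f (\<i> * of_real (2 * pi / s))"
      by (simp only: exp_of_real)
    from sums_divide[OF this, of "of_real (s ^ Suc (Suc k))"] show ?thesis by simp
  qed
  ultimately show ?thesis by (simp add: sums_iff)
qed

lemma modular_imaginary_axis:
  assumes s: "s > 0"
  shows "f (\<i> * of_real (2 * pi / s)) =
    (\<i> * of_real (s / (2 * pi))) ^ k * f (\<i> * of_real (s / (2 * pi)))"
proof -
  let ?z = "\<i> * of_real (s / (2 * pi)) :: complex"
  have "f ((of_int 0 * ?z + of_int (-1)) / (of_int 1 * ?z + of_int 0)) =
      (of_int 1 * ?z + of_int 0) powi int k * f ?z"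
    using modular[unfolded weakly_modular_def, rule_format, of 0 0 "-1" 1 ?z] s by simp
  moreover have "(of_int 0 * ?z + of_int (-1)) / (of_int 1 * ?z + of_int 0) = \<i> * of_real (2 * pi / s)"
    using s by (simp add: field_simps)
  ultimately show ?thesis by simp
qed

theorem voronoi_riesz:
  assumes x: "x \<ge> 0"
  shows "(\<Sum>n. riesz_term n x) = (2 * of_real pi / \<i>) ^ k * (\<Sum>n. voronoi_term n x)"
proof -
  define c :: complex where "c = (2 * of_real pi / \<i>) ^ k"
  define G where "G x = (\<Sum>n. riesz_term n x) - c * (\<Sum>n. voronoi_term n x)" for x
  let ?w = "\<lambda>n. cmod (\<alpha> n) * real (Suc n) powr (- (real (Suc k) / 2 + 1/4))"
  obtain C where C: "C > 0" "\<And>n x. x \<ge> 0 \<Longrightarrow> norm (voronoi_term n x) \<le>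
    C * x powr (real (Suc k) / 2 - 1/4) * ?w n"
    by (rule norm_voronoi_term_le) (rule that, assumption, blast)
  have lap: "has_laplace G s 0" if s: "s > 0" for s
  proof -
    \<comment> \<open>The constant \<open>c\<close> cancels the powers of i and 2 pi in the
      automorphy factor; the remaining s^k reduces the denominator s^(k+2) to s^2.\<close>
    have "(2 * of_real pi / \<i>) ^ k * (\<i> * of_real (s / (2 * pi))) ^ k = (of_real s ^ k :: complex)"
      unfolding power_mult_distrib[symmetric] by simp
    then have "c * (f (\<i> * of_real (2 * pi / s)) / of_real (s ^ Suc (Suc k))) =
        f (\<i> * of_real (s / (2 * pi))) / of_real (s\<^sup>2)"
      unfolding modular_imaginary_axis[OF s] c_def using s
      by (simp add: mult.assoc[symmetric] power2_eq_square)
    then show ?thesis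
      using has_laplace_diff[OF has_laplace_riesz[OF s]
          has_laplace_linear[OF bounded_linear_mult_right[of c] has_laplace_voronoi[OF s]]]
      by (simp add: G_def[abs_def])
  qed
  have cont_r: "continuous_on {0..} (\<lambda>x. \<Sum>n. riesz_term n x)"
  proof (rule continuous_on_suminf_atLeast)
    show "continuous_on {0..} (riesz_term n)" for n
      unfolding riesz_term_def[abs_def] by (intro continuous_intros)
    fix b :: real
    let ?B = "\<lambda>n. cmod (\<alpha> n) * exp (- (real (Suc n) / 4)) * (4 * exp (b / 2))"
    have "norm (riesz_term n x) \<le> ?B n" if "x \<in> {0..b}" for n x
    proof -
      have "norm (riesz_term n x) \<le> cmod (\<alpha> n) * exp (- (real (Suc n) / 4)) * (4 * exp (x / 2))"
        by (rule norm_riesz_term_le) (use that in simp)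
      also have "\<dots> \<le> ?B n" using that by (intro mult_left_mono) auto
      finally show ?thesis .
    qed
    then show "\<exists>B. summable B \<and> (\<forall>n. \<forall>x\<in>{0..b}. norm (riesz_term n x) \<le> B n)"
      by (intro exI[of _ ?B]) (use summable_mult2[OF summable_quarter] in blast)
  qed
  have cont_v: "continuous_on {0..} (\<lambda>x. \<Sum>n. voronoi_term n x)"
  proof (rule continuous_on_suminf_atLeast)
    show "continuous_on {0..} (voronoi_term n)" for n
      unfolding voronoi_term_def[abs_def] by (intro continuous_intros)
    fix b :: real
    let ?B = "\<lambda>n. C * b powr (real (Suc k) / 2 - 1/4) * ?w n"
    have "norm (voronoi_term n x) \<le> ?B n" if "x \<in> {0..b}" for n x
    proof -
      have "norm (voronoi_term n x) \<le> C * x powr (real (Suc k) / 2 - 1/4) * ?w n"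
        by (rule C(2)) (use that in simp)
      also have "\<dots> \<le> ?B n"
        using that C(1) k_pos by (intro mult_right_mono mult_left_mono powr_mono2) auto
      finally show ?thesis .
    qed
    then show "\<exists>B. summable B \<and> (\<forall>n. \<forall>x\<in>{0..b}. norm (voronoi_term n x) \<le> B n)"
      by (intro exI[of _ ?B]) (use summable_mult[OF summable_voronoi_weight] in blast)
  qed
  have cont: "continuous_on {0..} G"
    unfolding G_def[abs_def] by (intro continuous_intros cont_r cont_v)
  define A where "A = (\<Sum>n. cmod (\<alpha> n) * exp (- (real (Suc n) / 4)))"
  define W where "W = (\<Sum>n. ?w n)"
  have W0: "W \<ge> 0" unfolding W_def by (intro suminf_nonneg summable_voronoi_weight) auto
  \<comment> \<open>From x^(k+1) = 2^(k+1) (x/2)^(k+1) \<le> 2^(k+1) (k+1)! exp(x/2): polynomial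
    growth is put into the form exp(x/2).\<close>
  define F :: real where "F = 1 + 2 ^ Suc k * fact (Suc k)"
  define D where "D = A * 4 + cmod c * (C * F * W)"
  have bound: "cmod (G x) \<le> D * exp (x / 2)" if x: "x \<ge> 0" for x
  proof -
    have s1: "summable (\<lambda>n. cmod (\<alpha> n) * exp (- (real (Suc n) / 4)) * (4 * exp (x / 2)))"
      by (intro summable_mult2 summable_quarter)
    have "cmod (\<Sum>n. riesz_term n x) \<le> (\<Sum>n. cmod (\<alpha> n) * exp (- (real (Suc n) / 4)) * (4 * exp (x / 2)))"
      by (rule norm_suminf_le[OF norm_riesz_term_le[OF x] s1])
    also have "\<dots> = A * (4 * exp (x / 2))"
      unfolding A_def by (rule suminf_mult2[OF summable_quarter, symmetric])
    finally have 1: "cmod (\<Sum>n. riesz_term n x) \<le> A * 4 * exp (x / 2)" by simp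
    have "x powr (real (Suc k) / 2 - 1/4) \<le> 1 + x ^ Suc k"
      by (rule powr_le_one_plus_power[OF x])
    also have "\<dots> = 1 + 2 ^ Suc k * (x / 2) ^ Suc k"
      by (simp add: power_divide)
    also have "\<dots> \<le> exp (x / 2) + 2 ^ Suc k * (fact (Suc k) * exp (x / 2))"
      using x power_le_fact_exp[of "x / 2" "Suc k"] by (intro add_mono mult_left_mono) auto
    also have "\<dots> = F * exp (x / 2)"
      by (simp add: F_def algebra_simps)
    finally have px: "x powr (real (Suc k) / 2 - 1/4) \<le> F * exp (x / 2)" .
    have "cmod (\<Sum>n. voronoi_term n x) \<le> (\<Sum>n. C * x powr (real (Suc k) / 2 - 1/4) * ?w n)"
      by (rule norm_suminf_le[OF C(2)[OF x] summable_mult[OF summable_voronoi_weight]])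
    also have "\<dots> = C * x powr (real (Suc k) / 2 - 1/4) * W"
      unfolding W_def by (rule suminf_mult[OF summable_voronoi_weight])
    also have "\<dots> \<le> C * (F * exp (x / 2)) * W"
      using px C(1) W0 by (intro mult_right_mono mult_left_mono) auto
    finally have 2: "cmod (\<Sum>n. voronoi_term n x) \<le> C * (F * exp (x / 2)) * W" .
    have "cmod (G x) \<le> cmod (\<Sum>n. riesz_term n x) + cmod c * cmod (\<Sum>n. voronoi_term n x)"
      unfolding G_def by (rule order_trans[OF norm_triangle_ineq4]) (simp add: norm_mult)
    also have "\<dots> \<le> A * 4 * exp (x / 2) + cmod c * (C * (F * exp (x / 2)) * W)"
      by (intro add_mono 1 mult_left_mono 2) auto
    also have "\<dots> = D * exp (x / 2)"
      unfolding D_def distrib_right by (simp only: mult_ac)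
    finally show ?thesis .
  qed
  have "Re (G x) = 0"
  proof (rule laplace_zero_imp_zero[where C = D and G = "\<lambda>x. Re (G x)", OF _ _ _ x])
    show "continuous_on {0..} (\<lambda>x. Re (G x))"
      by (intro continuous_intros cont)
    show "\<bar>Re (G x)\<bar> \<le> D * exp (x / 2)" if "x \<ge> 0" for x
      by (rule order_trans[OF abs_Re_le_cmod bound[OF that]])
    show "has_laplace (\<lambda>x. Re (G x)) (real (Suc n)) 0" for n
      using has_laplace_linear[OF bounded_linear_Re lap[of "real (Suc n)"]] by simp
  qed
  moreover have "Im (G x) = 0"
  proof (rule laplace_zero_imp_zero[where C = D and G = "\<lambda>x. Im (G x)", OF _ _ _ x])
    show "continuous_on {0..} (\<lambda>x. Im (G x))"
      by (intro continuous_intros cont)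
    show "\<bar>Im (G x)\<bar> \<le> D * exp (x / 2)" if "x \<ge> 0" for x
      by (rule order_trans[OF abs_Im_le_cmod bound[OF that]])
    show "has_laplace (\<lambda>x. Im (G x)) (real (Suc n)) 0" for n
      using has_laplace_linear[OF bounded_linear_Im lap[of "real (Suc n)"]] by simp
  qed
  ultimately have "G x = 0" by (simp add: complex_eq_iff)
  then show ?thesis by (simp add: G_def c_def)
qed

end

section \<open>Mean squares\<close>

text \<open>A variance is nonnegative: on an interval of length 1 the integral of \<open>g\<close>
  is its mean \<open>J\<close>, and the integrand used is (g - J)^2.\<close>

lemma square_integral_le:
  fixes g :: "real \<Rightarrow> real"
  assumes "continuous_on {a..a + 1} g"
  shows "(integral {a..a + 1} g)\<^sup>2 \<le> integral {a..a + 1} (\<lambda>t. (g t)\<^sup>2)"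
proof -
  define J where "J = integral {a..a + 1} g"
  define Q where "Q = integral {a..a + 1} (\<lambda>t. (g t)\<^sup>2)"
  have 1: "(g has_integral J) {a..a + 1}"
    unfolding J_def using assms by (intro integrable_integral integrable_continuous_real)
  have 2: "((\<lambda>t. (g t)\<^sup>2) has_integral Q) {a..a + 1}"
    unfolding Q_def using assms
    by (intro integrable_integral integrable_continuous_real continuous_intros)
  have "((\<lambda>t. (g t)\<^sup>2 - 2 * J * g t + J\<^sup>2) has_integral (Q - 2 * J * J + J\<^sup>2)) {a..a + 1}"
    using has_integral_add[OF has_integral_diff[OF 2 has_integral_mult_right[OF 1, of "2 * J"]]
        has_integral_const_real[of "J\<^sup>2" a "a + 1"]] by simp
  then have "0 \<le> Q - 2 * J * J + J\<^sup>2"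
  proof (rule has_integral_nonneg)
    fix t
    have "(g t)\<^sup>2 - 2 * J * g t + J\<^sup>2 = (g t - J)\<^sup>2" by (simp add: power2_eq_square algebra_simps)
    then show "0 \<le> (g t)\<^sup>2 - 2 * J * g t + J\<^sup>2" by simp
  qed
  then show ?thesis
    unfolding J_def[symmetric] Q_def[symmetric] by (simp add: power2_eq_square)
qed

lemma sum_integral_unit_intervals:
  fixes g :: "real \<Rightarrow> real"
  assumes "p \<le> q" "continuous_on {real p..} g"
  shows "(\<Sum>n=p..<q. integral {real n..real n + 1} g) = integral {real p..real q} g"
  using assms(1)
proof (induction q rule: dec_induct)
  case (step q)
  have "integral {real p..real q} g + integral {real q..real (Suc q)} g = integral {real p..real (Suc q)} g"
    using step.hyps
    by (intro Henstock_Kurzweil_Integration.integral_combine integrable_continuous_real continuous_on_subset[OF assms(2)]) auto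
  then show ?case using step by (simp add: add.commute)
qed simp

text \<open>Both factors solve \<open>(t * y')' = (v\<^sup>2 / (4 * t) - c) * y\<close> with \<open>c = l\<close> and \<open>c = m\<close>, so the product
  is, up to the factor \<open>l - m\<close>, the derivative of their Wronskian.\<close>

lemma lommel_integral:
  assumes lm: "l > 0" "m > 0" "l \<noteq> m" and ab: "0 < a" "a \<le> b"
  shows "integral {a..b} (\<lambda>t. bessel_sqrt v (l * t) * bessel_sqrt v (m * t)) =
    ((bessel_sqrt v (l * b) * bessel_sqrt_euler v (m * b) - bessel_sqrt_euler v (l * b) * bessel_sqrt v (m * b))
     - (bessel_sqrt v (l * a) * bessel_sqrt_euler v (m * a) - bessel_sqrt_euler v (l * a) * bessel_sqrt v (m * a)))
    / (l - m)"
proof -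
  let ?J = "bessel_sqrt v" and ?E = "bessel_sqrt_euler v"
  define F where "F t = ?J (l * t) * ?E (m * t) - ?E (l * t) * ?J (m * t)" for t
  have dJ: "((\<lambda>t. ?J (c * t)) has_real_derivative ?E (c * t) / t) (at t)" if "c > 0" "t > 0" for c t
  proof -
    have "((\<lambda>t. ?J (c * t)) has_real_derivative ?E (c * t) / (c * t) * c) (at t)"
      by (rule DERIV_chain2[OF bessel_sqrt_deriv])
         (use that in \<open>auto intro!: derivative_eq_intros\<close>)
    then show ?thesis using that by simp
  qed
  have dE: "((\<lambda>t. ?E (c * t)) has_real_derivative ((real v)\<^sup>2 / 4 - c * t) * ?J (c * t) / t) (at t)"
    if "c > 0" "t > 0" for c t
  proof -
    have "((\<lambda>t. ?E (c * t)) has_real_derivative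
        ((real v)\<^sup>2 / 4 - c * t) * ?J (c * t) / (c * t) * c) (at t)"
      by (rule DERIV_chain2[OF bessel_sqrt_euler_deriv])
         (use that in \<open>auto intro!: derivative_eq_intros\<close>)
    then show ?thesis using that by simp
  qed
  have "((\<lambda>t. (l - m) * (?J (l * t) * ?J (m * t))) has_integral (F b - F a)) {a..b}"
  proof (rule fundamental_theorem_of_calculus[OF ab(2)])
    fix t assume "t \<in> {a..b}"
    then have t: "t > 0" using ab by auto
    have "(F has_real_derivative
       (?E (l * t) / t * ?E (m * t) + ((real v)\<^sup>2 / 4 - m * t) * ?J (m * t) / t * ?J (l * t))
       - (((real v)\<^sup>2 / 4 - l * t) * ?J (l * t) / t * ?J (m * t) + ?E (m * t) / t * ?E (l * t))) (at t)"
      unfolding F_def[abs_def]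
      by (intro DERIV_diff DERIV_mult dJ dE lm t)
    moreover have "(?E (l * t) / t * ?E (m * t) + ((real v)\<^sup>2 / 4 - m * t) * ?J (m * t) / t * ?J (l * t))
       - (((real v)\<^sup>2 / 4 - l * t) * ?J (l * t) / t * ?J (m * t) + ?E (m * t) / t * ?E (l * t)) =
       (l - m) * (?J (l * t) * ?J (m * t))"
    proof -
      have "(e / t * e' + (w - m * t) * j' / t * j) - ((w - l * t) * j / t * j' + e' / t * e) =
          (l - m) * (j * j')" for e e' j j' w
        using t by (simp add: field_simps)
      then show ?thesis .
    qed
    ultimately show "(F has_vector_derivative (l - m) * (?J (l * t) * ?J (m * t))) (at t within {a..b})"
      by (simp add: has_real_derivative_iff_has_vector_derivative[symmetric]
          has_field_derivative_at_within)
  qed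
  from has_integral_mult_right[OF this, of "1 / (l - m)"]
  have "((\<lambda>t. ?J (l * t) * ?J (m * t)) has_integral (F b - F a) / (l - m)) {a..b}"
    using lm by simp
  then show ?thesis
    by (simp add: F_def integral_unique)
qed

lemma continuous_on_bessel_sqrt [continuous_intros]:
  "continuous_on A g \<Longrightarrow> continuous_on A (\<lambda>x. bessel_sqrt v (g x))"
  unfolding bessel_sqrt_def by (intro continuous_intros)

text \<open>A function of size x^(-1/4) meets an Euler derivative of size x^(1/4), so the powers of
  t cancel in Lommel's boundary terms. The off-diagonal bound is therefore independent of the
  interval, while the diagonal one grows with its length.\<close>

lemma bessel_sqrt_correlation_bounds:
  obtains C where "C > 0"
    "\<And>l m a b. l \<ge> 1 \<Longrightarrow> m \<ge> 1 \<Longrightarrow> l \<noteq> m \<Longrightarrow> 1 \<le> a \<Longrightarrow> a \<le> b \<Longrightarrow>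
      \<bar>integral {a..b} (\<lambda>t. bessel_sqrt v (l * t) * bessel_sqrt v (m * t))\<bar> \<le>
        C * (((l / m) powr (1/4) + (m / l) powr (1/4)) / \<bar>l - m\<bar>)"
    "\<And>l a b. l \<ge> 1 \<Longrightarrow> 1 \<le> a \<Longrightarrow> a \<le> b \<Longrightarrow>
      \<bar>integral {a..b} (\<lambda>t. bessel_sqrt v (l * t) * bessel_sqrt v (l * t))\<bar> \<le>
        C * ((b - a) * a powr (-1/2) * l powr (-1/2))"
proof -
  let ?J = "bessel_sqrt v" and ?E = "bessel_sqrt_euler v"
  obtain C where C: "C > 0" "\<And>x. x \<ge> 1 \<Longrightarrow> \<bar>?J x\<bar> \<le> C * x powr (-1/4)"
    "\<And>x. x \<ge> 1 \<Longrightarrow> \<bar>?E x\<bar> \<le> C * x powr (1/4)"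
    by (rule bessel_sqrt_bounds[of v]) blast
  have prod: "\<bar>?J (l * t) * ?E (m * t)\<bar> \<le> C\<^sup>2 * (m / l) powr (1/4)"
    if "l \<ge> 1" "m \<ge> 1" "t \<ge> 1" for l m t :: real
  proof -
    have ge: "l * t \<ge> 1" "m * t \<ge> 1" using that mult_mono[of 1 _ 1 t] by auto
    have "\<bar>?J (l * t) * ?E (m * t)\<bar> \<le> (C * (l * t) powr (-1/4)) * (C * (m * t) powr (1/4))"
      unfolding abs_mult by (intro mult_mono C ge) (use C(1) in auto)
    also have "\<dots> = C\<^sup>2 * (m / l) powr (1/4)"
      using that by (simp add: powr_mult powr_divide powr_minus power2_eq_square field_simps)
    finally show ?thesis .
  qed
  show ?thesis
  proof (rule that[of "2 * C\<^sup>2"])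
    show "2 * C\<^sup>2 > 0" using C(1) by simp
    fix l m a b :: real
    assume lm: "l \<ge> 1" "m \<ge> 1" "l \<noteq> m" and ab: "1 \<le> a" "a \<le> b"
    let ?K = "C\<^sup>2 * (m / l) powr (1/4) + C\<^sup>2 * (l / m) powr (1/4)"
    have F: "\<bar>?J (l * t) * ?E (m * t) - ?E (l * t) * ?J (m * t)\<bar> \<le> ?K" if "t \<ge> 1" for t
    proof -
      have "\<bar>?J (l * t) * ?E (m * t) - ?E (l * t) * ?J (m * t)\<bar> \<le>
          \<bar>?J (l * t) * ?E (m * t)\<bar> + \<bar>?J (m * t) * ?E (l * t)\<bar>"
        using abs_triangle_ineq4[of "?J (l * t) * ?E (m * t)" "?E (l * t) * ?J (m * t)"]
        by (simp only: mult.commute)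
      also have "\<dots> \<le> ?K"
        using lm that by (intro add_mono prod)
      finally show ?thesis .
    qed
    have "\<bar>integral {a..b} (\<lambda>t. ?J (l * t) * ?J (m * t))\<bar> \<le> (?K + ?K) / \<bar>l - m\<bar>"
    proof -
      have "\<bar>integral {a..b} (\<lambda>t. ?J (l * t) * ?J (m * t))\<bar> =
         \<bar>(?J (l * b) * ?E (m * b) - ?E (l * b) * ?J (m * b))
           - (?J (l * a) * ?E (m * a) - ?E (l * a) * ?J (m * a))\<bar> / \<bar>l - m\<bar>"
        using lm ab by (subst lommel_integral) auto
      also have "\<dots> \<le> (?K + ?K) / \<bar>l - m\<bar>"
        using ab by (intro divide_right_mono order_trans[OF abs_triangle_ineq4] add_mono F) auto
      finally show ?thesis .
    qed
    also have "\<dots> = 2 * C\<^sup>2 * (((l / m) powr (1/4) + (m / l) powr (1/4)) / \<bar>l - m\<bar>)"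
      by (simp add: distrib_left add_divide_distrib)
    finally show "\<bar>integral {a..b} (\<lambda>t. ?J (l * t) * ?J (m * t))\<bar> \<le>
        2 * C\<^sup>2 * (((l / m) powr (1/4) + (m / l) powr (1/4)) / \<bar>l - m\<bar>)" .
  next
    fix l a b :: real
    assume l: "l \<ge> 1" and ab: "1 \<le> a" "a \<le> b"
    let ?K = "C\<^sup>2 * (a powr (-1/2) * l powr (-1/2))"
    have "norm (integral {a..b} (\<lambda>t. ?J (l * t) * ?J (l * t))) \<le> ?K * (b - a)"
    proof (rule integral_bound[OF ab(2)])
      show "continuous_on {a..b} (\<lambda>t. ?J (l * t) * ?J (l * t))"
        by (intro continuous_intros)
      fix t assume t: "t \<in> {a..b}"
      have ge: "l * t \<ge> 1" using l t ab mult_mono[of 1 l 1 t] by auto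
      have "norm (?J (l * t) * ?J (l * t)) \<le> (C * (l * t) powr (-1/4)) * (C * (l * t) powr (-1/4))"
        unfolding real_norm_def abs_mult by (intro mult_mono C ge) (use C(1) in auto)
      also have "\<dots> = C\<^sup>2 * (l * t) powr (-1/2)"
      proof -
        have "(l * t) powr (-1/4) * (l * t) powr (-1/4) = (l * t) powr (-1/2)"
          unfolding powr_add[symmetric] by simp
        then show ?thesis by (simp add: power2_eq_square)
      qed
      also have "\<dots> \<le> C\<^sup>2 * (l * a) powr (-1/2)"
        using l t ab by (intro mult_left_mono powr_mono2') auto
      also have "\<dots> = ?K" by (simp add: powr_mult mult.commute)
      finally show "norm (?J (l * t) * ?J (l * t)) \<le> ?K" .
    qed
    also have "\<dots> \<le> 2 * C\<^sup>2 * ((b - a) * a powr (-1/2) * l powr (-1/2))"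
    proof -
      have "0 \<le> C\<^sup>2 * ((b - a) * a powr (-1/2) * l powr (-1/2))" using ab by simp
      then show ?thesis by (simp add: algebra_simps)
    qed
    finally show "\<bar>integral {a..b} (\<lambda>t. ?J (l * t) * ?J (l * t))\<bar> \<le>
        2 * C\<^sup>2 * ((b - a) * a powr (-1/2) * l powr (-1/2))" by simp
  qed
qed

text \<open>The weights on the right are chosen so that each sums to a harmonic number, however unequal
  \<open>x\<close> and \<open>y\<close> are.\<close>

lemma off_diagonal_term_le:
  fixes x y P Q :: real
  assumes xy: "x > 0" "y > 0" "x \<noteq> y" and PQ: "P \<ge> 0" "Q \<ge> 0"
  shows "P * Q * (((x / y) powr (1/4) + (y / x) powr (1/4)) / \<bar>x - y\<bar>) \<le>
    P\<^sup>2 * (1 / y + 1 / \<bar>x - y\<bar>) + Q\<^sup>2 * (1 / x + 1 / \<bar>x - y\<bar>)"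
proof -
  have main: "P * Q * (((x / y) powr (1/4) + (y / x) powr (1/4)) / \<bar>x - y\<bar>) \<le>
    P\<^sup>2 * (1 / y + 1 / \<bar>x - y\<bar>) + Q\<^sup>2 * (1 / x + 1 / \<bar>x - y\<bar>)"
    if xy: "0 < y" "y < x" and PQ: "P \<ge> 0" "Q \<ge> 0" for x y P Q :: real
  proof -
    define r where "r = (x / y) powr (1/4)"
    have r1: "r \<ge> 1" unfolding r_def using xy by (intro ge_one_powr_ge_zero) auto
    have "(y / x) powr (1/4) \<le> 1 powr (1/4)" using xy by (intro powr_mono2) auto
    then have "(y / x) powr (1/4) \<le> r" using r1 by simp
    then have "P * Q * (r + (y / x) powr (1/4)) \<le> P * Q * (r + r)"
      using PQ by (intro mult_left_mono) auto
    also have "\<dots> = 2 * (P * r) * Q" by simp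
    also have "\<dots> \<le> (P * r)\<^sup>2 + Q\<^sup>2" by (rule sum_squares_bound)
    \<comment> \<open>Enlarging r^2 to r^4 = x / y makes the partial fractions x / (y (x - y)) = 1/y
      + 1/(x - y) available.\<close>
    also have "(P * r)\<^sup>2 \<le> P\<^sup>2 * (x / y)"
    proof -
      have "r ^ 2 \<le> r ^ 4" using r1 by (intro power_increasing) auto
      also have "r ^ 4 = r powr real 4"
        using r1 by (subst powr_realpow) auto
      also have "\<dots> = (x / y) powr (1/4 * real 4)"
        unfolding r_def by (rule powr_powr)
      also have "\<dots> = x / y" using xy by simp
      finally show ?thesis
        using mult_left_mono[of "r\<^sup>2" "x / y" "P\<^sup>2"] by (simp add: power_mult_distrib)
    qed
    finally have "P * Q * (r + (y / x) powr (1/4)) / (x - y) \<le> (P\<^sup>2 * (x / y) + Q\<^sup>2) / (x - y)"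
      using xy by (intro divide_right_mono) auto
    also have "\<dots> = P\<^sup>2 * (x / y / (x - y)) + Q\<^sup>2 * (1 / (x - y))"
      by (simp add: add_divide_distrib)
    also have "\<dots> = P\<^sup>2 * (1 / y + 1 / (x - y)) + Q\<^sup>2 * (1 / (x - y))"
    proof -
      have "x / y / (x - y) = 1 / y + 1 / (x - y)"
        using xy by (simp add: divide_simps)
      then show ?thesis by (simp only:)
    qed
    also have "\<dots> \<le> P\<^sup>2 * (1 / y + 1 / (x - y)) + Q\<^sup>2 * (1 / x + 1 / (x - y))"
      using xy by (intro add_left_mono mult_left_mono) auto
    finally show ?thesis using xy by (simp add: r_def)
  qed
  show ?thesis
  proof (cases "y < x")
    case True
    then show ?thesis using main[of y x P Q] xy PQ by simp
  next
    case False
    then show ?thesis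
      using main[of x y Q P] xy PQ by (simp add: abs_minus_commute add.commute mult.commute)
  qed
qed

lemma sum_inverse_distance_le:
  fixes n N :: nat
  assumes "n < N"
  shows "(\<Sum>m\<in>{..<N} - {n}. 1 / \<bar>real n - real m\<bar>) \<le> 2 * (\<Sum>d<N. 1 / real (Suc d))"
proof -
  have split: "{..<N} - {n} = {..<n} \<union> {n<..<N}" using assms by auto
  have "(\<Sum>m<n. 1 / \<bar>real n - real m\<bar>) = (\<Sum>d<n. 1 / real (Suc d))"
    by (rule sum.reindex_bij_witness[of _ "\<lambda>d. n - Suc d" "\<lambda>m. n - Suc m"]) auto
  also have "\<dots> \<le> (\<Sum>d<N. 1 / real (Suc d))"
    using assms by (intro sum_mono2) auto
  finally have 1: "(\<Sum>m<n. 1 / \<bar>real n - real m\<bar>) \<le> (\<Sum>d<N. 1 / real (Suc d))" .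
  have "(\<Sum>m\<in>{n<..<N}. 1 / \<bar>real n - real m\<bar>) = (\<Sum>d<N - Suc n. 1 / real (Suc d))"
    by (rule sum.reindex_bij_witness[of _ "\<lambda>d. n + Suc d" "\<lambda>m. m - Suc n"]) auto
  also have "\<dots> \<le> (\<Sum>d<N. 1 / real (Suc d))"
    by (intro sum_mono2) auto
  finally have 2: "(\<Sum>m\<in>{n<..<N}. 1 / \<bar>real n - real m\<bar>) \<le> (\<Sum>d<N. 1 / real (Suc d))" .
  have "(\<Sum>m\<in>{..<N} - {n}. 1 / \<bar>real n - real m\<bar>) =
      (\<Sum>m<n. 1 / \<bar>real n - real m\<bar>) + (\<Sum>m\<in>{n<..<N}. 1 / \<bar>real n - real m\<bar>)"
    unfolding split by (intro sum.union_disjoint) auto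
  then show ?thesis using 1 2 by simp
qed

text \<open>A substitute for Hilbert's inequality that loses a logarithm. For fixed n the weights
  sum to at most 3H, where H is the harmonic sum: H from 1/(m+1) and 2H from the two sides of n. The
  two symmetric halves make 6H.\<close>

lemma off_diagonal_sum_le:
  fixes c :: "nat \<Rightarrow> real"
  assumes c: "\<And>n. c n \<ge> 0"
  shows "(\<Sum>n<N. \<Sum>m\<in>{..<N} - {n}. c n * c m *
      (((real (Suc n) / real (Suc m)) powr (1/4) + (real (Suc m) / real (Suc n)) powr (1/4))
        / \<bar>real n - real m\<bar>))
    \<le> 6 * (\<Sum>d<N. 1 / real (Suc d)) * (\<Sum>n<N. (c n)\<^sup>2)"
proof -
  define H where "H = (\<Sum>d<N. 1 / real (Suc d))"
  define g where "g n m = 1 / real (Suc m) + 1 / \<bar>real n - real m\<bar>" for n m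
  have inner: "(\<Sum>m\<in>{..<N} - {n}. g n m) \<le> 3 * H" if "n < N" for n
  proof -
    have "(\<Sum>m\<in>{..<N} - {n}. 1 / real (Suc m)) \<le> H"
      unfolding H_def by (intro sum_mono2) auto
    then show ?thesis
      using sum_inverse_distance_le[OF that] by (simp add: g_def sum.distrib H_def)
  qed
  have half: "(\<Sum>n<N. \<Sum>m\<in>{..<N} - {n}. (c n)\<^sup>2 * g n m) \<le> 3 * H * (\<Sum>n<N. (c n)\<^sup>2)"
  proof -
    have "(\<Sum>n<N. \<Sum>m\<in>{..<N} - {n}. (c n)\<^sup>2 * g n m) \<le> (\<Sum>n<N. (c n)\<^sup>2 * (3 * H))"
      unfolding sum_distrib_left[symmetric] by (intro sum_mono mult_left_mono inner) auto
    also have "\<dots> = 3 * H * (\<Sum>n<N. (c n)\<^sup>2)"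
      by (simp add: sum_distrib_left mult.commute)
    finally show ?thesis .
  qed
  have swap: "(\<Sum>n<N. \<Sum>m\<in>{..<N} - {n}. (c m)\<^sup>2 * g m n) =
      (\<Sum>n<N. \<Sum>m\<in>{..<N} - {n}. (c n)\<^sup>2 * g n m)"
  proof -
    have "(\<Sum>n<N. \<Sum>m\<in>{..<N} - {n}. h n m) = (\<Sum>n<N. \<Sum>m<N. if n = m then 0 else h n m)"
      for h :: "nat \<Rightarrow> nat \<Rightarrow> real"
      by (intro sum.cong refl sum.mono_neutral_cong_left) auto
    note eq = this
    show ?thesis
      unfolding eq by (subst sum.swap) (simp add: eq_commute)
  qed
  have "(\<Sum>n<N. \<Sum>m\<in>{..<N} - {n}. c n * c m *
      (((real (Suc n) / real (Suc m)) powr (1/4) + (real (Suc m) / real (Suc n)) powr (1/4))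
        / \<bar>real n - real m\<bar>)) \<le>
      (\<Sum>n<N. \<Sum>m\<in>{..<N} - {n}. (c n)\<^sup>2 * g n m + (c m)\<^sup>2 * g m n)"
  proof (intro sum_mono)
    fix n m assume nm: "n \<in> {..<N}" "m \<in> {..<N} - {n}"
    have d: "\<bar>real (Suc n) - real (Suc m)\<bar> = \<bar>real n - real m\<bar>" by simp
    have d': "\<bar>real m - real n\<bar> = \<bar>real n - real m\<bar>" by (rule abs_minus_commute)
    show "c n * c m *
      (((real (Suc n) / real (Suc m)) powr (1/4) + (real (Suc m) / real (Suc n)) powr (1/4))
        / \<bar>real n - real m\<bar>) \<le> (c n)\<^sup>2 * g n m + (c m)\<^sup>2 * g m n"
      using off_diagonal_term_le[of "real (Suc n)" "real (Suc m)" "c n" "c m"] nm c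
      unfolding g_def d d' by (simp del: of_nat_Suc)
  qed
  also have "\<dots> \<le> 3 * H * (\<Sum>n<N. (c n)\<^sup>2) + 3 * H * (\<Sum>n<N. (c n)\<^sup>2)"
    unfolding sum.distrib swap by (intro add_mono half)
  also have "\<dots> = 6 * H * (\<Sum>n<N. (c n)\<^sup>2)" by simp
  finally show ?thesis unfolding H_def .
qed

section \<open>Mean square of a finite sum of Bessel functions\<close>

lemma integral_cmod_sum_square_le:
  fixes J :: "nat \<Rightarrow> real \<Rightarrow> real" and u :: "nat \<Rightarrow> complex"
  assumes J: "\<And>n. continuous_on {a..b} (J n)"
  shows "integral {a..b} (\<lambda>t. (cmod (\<Sum>n<N. u n * of_real (J n t)))\<^sup>2) \<le>
    (\<Sum>n<N. \<Sum>m<N. cmod (u n) * cmod (u m) * \<bar>integral {a..b} (\<lambda>t. J n t * J m t)\<bar>)"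
proof -
  have eq: "(cmod (\<Sum>n<N. u n * of_real (J n t)))\<^sup>2 =
      (\<Sum>n<N. \<Sum>m<N. Re (u n * cnj (u m)) * (J n t * J m t))" for t
  proof -
    have "complex_of_real ((cmod (\<Sum>n<N. u n * of_real (J n t)))\<^sup>2) =
        (\<Sum>n<N. \<Sum>m<N. u n * cnj (u m) * of_real (J n t * J m t))"
      unfolding complex_norm_square cnj_sum sum_product by (simp add: mult_ac)
    from arg_cong[OF this, of Re] show ?thesis by simp
  qed
  have int: "(\<lambda>t. J n t * J m t) integrable_on {a..b}" for n m
    by (intro integrable_continuous_real continuous_intros J)
  have "integral {a..b} (\<lambda>t. (cmod (\<Sum>n<N. u n * of_real (J n t)))\<^sup>2) =
      (\<Sum>n<N. \<Sum>m<N. Re (u n * cnj (u m)) * integral {a..b} (\<lambda>t. J n t * J m t))"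
    unfolding eq
    by (intro integral_unique has_integral_sum has_integral_mult_right integrable_integral int) auto
  also have "\<dots> \<le> (\<Sum>n<N. \<Sum>m<N. cmod (u n) * cmod (u m) * \<bar>integral {a..b} (\<lambda>t. J n t * J m t)\<bar>)"
  proof (intro sum_mono)
    fix n m
    let ?I = "integral {a..b} (\<lambda>t. J n t * J m t)"
    have "Re (u n * cnj (u m)) * ?I \<le> \<bar>Re (u n * cnj (u m))\<bar> * \<bar>?I\<bar>"
      unfolding abs_mult[symmetric] by (rule abs_ge_self)
    also have "\<dots> \<le> cmod (u n * cnj (u m)) * \<bar>?I\<bar>"
      by (intro mult_right_mono abs_Re_le_cmod) auto
    finally show "Re (u n * cnj (u m)) * ?I \<le> cmod (u n) * cmod (u m) * \<bar>?I\<bar>"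
      by (simp add: norm_mult)
  qed
  finally show ?thesis .
qed

lemma four_pi_square_ge_one: "1 \<le> 4 * pi\<^sup>2"
proof -
  have "1 \<le> pi\<^sup>2"
    by (rule one_le_power) (use pi_gt3 in linarith)
  then show ?thesis by linarith
qed

text \<open>An inequality of large-sieve type: the frequencies 4 pi^2 (n + 1) are at least 1 apart,
  so only the diagonal sees the length b - a.\<close>

lemma bessel_sqrt_mean_square:
  obtains C where "C > 0" "\<And>u N a b. 1 \<le> a \<Longrightarrow> a \<le> b \<Longrightarrow>
    integral {a..b} (\<lambda>t. (cmod (\<Sum>n<N. u n * of_real (bessel_sqrt v (4 * pi\<^sup>2 * real (Suc n) * t))))\<^sup>2) \<le>
    C * ((b - a) * a powr (-1/2) * (\<Sum>n<N. (cmod (u n))\<^sup>2 * real (Suc n) powr (-1/2))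
       + (\<Sum>d<N. 1 / real (Suc d)) * (\<Sum>n<N. (cmod (u n))\<^sup>2))"
proof -
  define L where "L n = 4 * pi\<^sup>2 * real (Suc n)" for n
  note pi2 = four_pi_square_ge_one
  have L_ge: "L n \<ge> real (Suc n)" for n
    unfolding L_def using mult_right_mono[OF pi2, of "real (Suc n)"] by simp
  have L1: "L n \<ge> 1" for n using L_ge[of n] by simp
  have L_ratio: "L n / L m = real (Suc n) / real (Suc m)" for n m
    by (simp add: L_def del: of_nat_Suc)
  have L_diff: "\<bar>L n - L m\<bar> \<ge> \<bar>real n - real m\<bar>" for n m
  proof -
    have "L n - L m = 4 * pi\<^sup>2 * (real n - real m)" by (simp add: L_def algebra_simps)
    then have "\<bar>L n - L m\<bar> = 4 * pi\<^sup>2 * \<bar>real n - real m\<bar>" by (simp add: abs_mult)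
    then show ?thesis using mult_right_mono[OF pi2, of "\<bar>real n - real m\<bar>"] by simp
  qed
  have L_inj: "L n \<noteq> L m" if "n \<noteq> m" for n m
    using L_diff[of n m] that by auto
  obtain C where C: "C > 0"
    "\<And>l m a b. l \<ge> 1 \<Longrightarrow> m \<ge> 1 \<Longrightarrow> l \<noteq> m \<Longrightarrow> 1 \<le> a \<Longrightarrow> a \<le> b \<Longrightarrow>
      \<bar>integral {a..b} (\<lambda>t. bessel_sqrt v (l * t) * bessel_sqrt v (m * t))\<bar> \<le>
        C * (((l / m) powr (1/4) + (m / l) powr (1/4)) / \<bar>l - m\<bar>)"
    "\<And>l a b. l \<ge> 1 \<Longrightarrow> 1 \<le> a \<Longrightarrow> a \<le> b \<Longrightarrow>
      \<bar>integral {a..b} (\<lambda>t. bessel_sqrt v (l * t) * bessel_sqrt v (l * t))\<bar> \<le>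
        C * ((b - a) * a powr (-1/2) * l powr (-1/2))"
    by (rule bessel_sqrt_correlation_bounds[of v]) blast
  show ?thesis
  proof (rule that[of "6 * C"])
    show "6 * C > 0" using C(1) by simp
    fix u :: "nat \<Rightarrow> complex" and N and a b :: real
    assume ab: "1 \<le> a" "a \<le> b"
    define I where "I n m = \<bar>integral {a..b} (\<lambda>t. bessel_sqrt v (L n * t) * bessel_sqrt v (L m * t))\<bar>" for n m
    define w where "w n m = ((real (Suc n) / real (Suc m)) powr (1/4) + (real (Suc m) / real (Suc n)) powr (1/4))
        / \<bar>real n - real m\<bar>" for n m
    have diag: "I n n \<le> C * ((b - a) * a powr (-1/2) * real (Suc n) powr (-1/2))" for n
    proof -
      have "I n n \<le> C * ((b - a) * a powr (-1/2) * L n powr (-1/2))"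
        unfolding I_def by (rule C(3)[OF L1 ab])
      also have "\<dots> \<le> C * ((b - a) * a powr (-1/2) * real (Suc n) powr (-1/2))"
        using C(1) ab L_ge[of n] by (intro mult_left_mono powr_mono2') auto
      finally show ?thesis .
    qed
    have off: "I n m \<le> C * w n m" if "n \<noteq> m" for n m
    proof -
      have "I n m \<le> C * (((L n / L m) powr (1/4) + (L m / L n) powr (1/4)) / \<bar>L n - L m\<bar>)"
        unfolding I_def by (rule C(2)[OF L1 L1 L_inj[OF that] ab])
      also have "\<dots> \<le> C * w n m"
        unfolding L_ratio w_def using C(1) that L_diff[of n m]
        by (intro mult_left_mono divide_left_mono mult_pos_pos) (auto simp: L_inj)
      finally show ?thesis .
    qed
    have "integral {a..b} (\<lambda>t. (cmod (\<Sum>n<N. u n * of_real (bessel_sqrt v (L n * t))))\<^sup>2) \<le>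
        (\<Sum>n<N. \<Sum>m<N. cmod (u n) * cmod (u m) * I n m)"
      unfolding I_def by (intro integral_cmod_sum_square_le continuous_intros)
    also have "\<dots> = (\<Sum>n<N. cmod (u n) * cmod (u n) * I n n + (\<Sum>m\<in>{..<N} - {n}. cmod (u n) * cmod (u m) * I n m))"
      by (intro sum.cong refl sum.remove) auto
    also have "\<dots> \<le> (\<Sum>n<N. cmod (u n) * cmod (u n) * (C * ((b - a) * a powr (-1/2) * real (Suc n) powr (-1/2)))
        + (\<Sum>m\<in>{..<N} - {n}. cmod (u n) * cmod (u m) * (C * w n m)))"
      by (intro sum_mono add_mono mult_left_mono diag off) auto
    also have "\<dots> = C * ((b - a) * a powr (-1/2) * (\<Sum>n<N. (cmod (u n))\<^sup>2 * real (Suc n) powr (-1/2)))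
        + C * (\<Sum>n<N. \<Sum>m\<in>{..<N} - {n}. cmod (u n) * cmod (u m) * w n m)"
      unfolding sum.distrib sum_distrib_left
      by (intro arg_cong2[where f = "(+)"] sum.cong refl) (simp_all add: power2_eq_square mult_ac)
    also have "\<dots> \<le> 6 * C * ((b - a) * a powr (-1/2) * (\<Sum>n<N. (cmod (u n))\<^sup>2 * real (Suc n) powr (-1/2)))
        + C * (6 * (\<Sum>d<N. 1 / real (Suc d)) * (\<Sum>n<N. (cmod (u n))\<^sup>2))"
    proof (intro add_mono mult_left_mono)
      have "0 \<le> (b - a) * a powr (-1/2) * (\<Sum>n<N. (cmod (u n))\<^sup>2 * real (Suc n) powr (-1/2))"
        using ab by (intro mult_nonneg_nonneg sum_nonneg) auto
      then show "C * ((b - a) * a powr (-1/2) * (\<Sum>n<N. (cmod (u n))\<^sup>2 * real (Suc n) powr (-1/2))) \<le>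
        6 * C * ((b - a) * a powr (-1/2) * (\<Sum>n<N. (cmod (u n))\<^sup>2 * real (Suc n) powr (-1/2)))"
        using C(1) by (intro mult_right_mono) auto
      show "(\<Sum>n<N. \<Sum>m\<in>{..<N} - {n}. cmod (u n) * cmod (u m) * w n m) \<le>
          6 * (\<Sum>d<N. 1 / real (Suc d)) * (\<Sum>n<N. (cmod (u n))\<^sup>2)"
        unfolding w_def by (rule off_diagonal_sum_le) simp
    qed (use C(1) in auto)
    finally show "integral {a..b} (\<lambda>t. (cmod (\<Sum>n<N. u n * of_real (bessel_sqrt v (4 * pi\<^sup>2 * real (Suc n) * t))))\<^sup>2) \<le>
      6 * C * ((b - a) * a powr (-1/2) * (\<Sum>n<N. (cmod (u n))\<^sup>2 * real (Suc n) powr (-1/2))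
       + (\<Sum>d<N. 1 / real (Suc d)) * (\<Sum>n<N. (cmod (u n))\<^sup>2))"
      unfolding L_def by (simp add: distrib_left mult_ac)
  qed
qed

text \<open>The classical rule that the derivative of z^v J_v is z^v J_{v-1}. It makes the increment
  of a Voronoi term of index k + 1 an integral of a term of index k.\<close>

lemma power_bessel_clifford_deriv:
  "((\<lambda>x. x ^ Suc v * bessel_clifford (Suc v) (l * x)) has_real_derivative
     x ^ v * bessel_clifford v (l * x)) (at x)"
proof -
  have 1: "((\<lambda>x. bessel_clifford (Suc v) (l * x)) has_real_derivative
      - bessel_clifford (Suc (Suc v)) (l * x) * l) (at x)"
    by (rule bessel_clifford_deriv') (auto intro!: derivative_eq_intros)
  have 2: "((\<lambda>x. x ^ Suc v) has_real_derivative real (Suc v) * x ^ v) (at x)"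
    using DERIV_pow[of "Suc v" x UNIV] by simp
  have "((\<lambda>x. x ^ Suc v * bessel_clifford (Suc v) (l * x)) has_real_derivative
      real (Suc v) * x ^ v * bessel_clifford (Suc v) (l * x) +
      - bessel_clifford (Suc (Suc v)) (l * x) * l * x ^ Suc v) (at x)"
    by (rule DERIV_mult[OF 2 1])
  moreover have "real (Suc v) * x ^ v * bessel_clifford (Suc v) (l * x) +
      - bessel_clifford (Suc (Suc v)) (l * x) * l * x ^ Suc v =
      x ^ v * (real (Suc v) * bessel_clifford (Suc v) (l * x) - (l * x) * bessel_clifford (Suc (Suc v)) (l * x))"
    by (simp add: algebra_simps)
  ultimately show ?thesis
    by (simp only: bessel_clifford_rec[symmetric])
qed

text \<open>Rankin's trick: for n < M the factor (M / (n + 1))^e is at least 1, and inserting it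
  moves the exponent into the range of convergence.\<close>

lemma weighted_sum_le:
  fixes b :: "nat \<Rightarrow> real"
  assumes b: "\<And>n. b n \<ge> 0" and e: "e \<ge> 0"
    and sm: "summable (\<lambda>n. b n * real (Suc n) powr (- (s + e)))"
  shows "(\<Sum>n<M. b n * real (Suc n) powr (- s)) \<le>
    real M powr e * (\<Sum>n. b n * real (Suc n) powr (- (s + e)))"
proof -
  have "(\<Sum>n<M. b n * real (Suc n) powr (- s)) \<le>
      (\<Sum>n<M. real M powr e * (b n * real (Suc n) powr (- (s + e))))"
  proof (intro sum_mono)
    fix n assume "n \<in> {..<M}"
    then have le: "real (Suc n) powr e \<le> real M powr e" using e by (intro powr_mono2) auto
    have "real (Suc n) powr (- s) = real (Suc n) powr e * real (Suc n) powr (- (s + e))"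
      unfolding powr_add[symmetric] by simp
    then have "b n * real (Suc n) powr (- s) =
        real (Suc n) powr e * (b n * real (Suc n) powr (- (s + e)))"
      by (simp only: mult_ac)
    also have "\<dots> \<le> real M powr e * (b n * real (Suc n) powr (- (s + e)))"
      by (intro mult_right_mono le) (use b in auto)
    finally show "b n * real (Suc n) powr (- s) \<le> real M powr e * (b n * real (Suc n) powr (- (s + e)))" .
  qed
  also have "\<dots> = real M powr e * (\<Sum>n<M. b n * real (Suc n) powr (- (s + e)))"
    by (rule sum_distrib_left[symmetric])
  also have "\<dots> \<le> real M powr e * (\<Sum>n. b n * real (Suc n) powr (- (s + e)))"
    by (intro mult_left_mono sum_le_suminf sm) (use b in auto)
  finally show ?thesis .
qed

section \<open>Partial sums of the coefficients in mean square\<close>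

context cusp_expansion
begin

lemma summable_riesz_term: "x \<ge> 0 \<Longrightarrow> summable (\<lambda>n. riesz_term n x)"
  by (rule summable_comparison_test'[OF summable_mult2[OF summable_quarter, of "4 * exp (x / 2)"]])
     (use norm_riesz_term_le in blast)

text \<open>From n to n + 1 the ramp of an index \<open>Suc m \<le> n\<close> rises by exactly 1,
  and that of a larger index is still 0 at n + 1.\<close>

lemma partial_sum_eq_riesz_diff:
  "(\<Sum>m<n. \<alpha> m) = (\<Sum>m. riesz_term m (real n + 1)) - (\<Sum>m. riesz_term m (real n))"
proof -
  have "(\<Sum>m. riesz_term m (real n + 1)) - (\<Sum>m. riesz_term m (real n)) =
      (\<Sum>m. riesz_term m (real n + 1) - riesz_term m (real n))"
    by (intro suminf_diff summable_riesz_term) auto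
  also have "\<dots> = (\<Sum>m<n. riesz_term m (real n + 1) - riesz_term m (real n))"
    by (rule suminf_finite) (auto simp: riesz_term_def max_def)
  also have "\<dots> = (\<Sum>m<n. \<alpha> m)"
  proof (intro sum.cong refl)
    fix m assume "m \<in> {..<n}"
    then have "real n \<ge> real (Suc m)" by simp
    then show "riesz_term m (real n + 1) - riesz_term m (real n) = \<alpha> m"
      by (simp add: riesz_term_def algebra_simps)
  qed
  finally show ?thesis by simp
qed

text \<open>The termwise derivative of the Voronoi series. It is cut off at M because the bound for
  index k, on average m^(-3/4), is not summable.\<close>

definition voronoi_head :: "nat \<Rightarrow> real \<Rightarrow> complex" where
  "voronoi_head M t = (\<Sum>m<M. \<alpha> m * of_real (t ^ k * bessel_clifford k (4 * pi\<^sup>2 * real (Suc m) * t)))"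

lemma continuous_on_voronoi_head [continuous_intros]: "continuous_on A (voronoi_head M)"
  unfolding voronoi_head_def[abs_def] by (intro continuous_intros)

lemma voronoi_head_integral:
  "(\<Sum>m<M. voronoi_term m (t + 1) - voronoi_term m t) = integral {t..t + 1} (voronoi_head M)"
proof -
  have "(voronoi_head M has_integral
      (\<Sum>m<M. voronoi_term m (t + 1)) - (\<Sum>m<M. voronoi_term m t)) {t..t + 1}"
  proof (rule fundamental_theorem_of_calculus)
    fix x assume "x \<in> {t..t + 1}"
    show "((\<lambda>x. \<Sum>m<M. voronoi_term m x) has_vector_derivative voronoi_head M x) (at x within {t..t + 1})"
      unfolding voronoi_term_def voronoi_head_def
      by (intro has_vector_derivative_sum has_vector_derivative_mult_right
          has_vector_derivative_of_real has_vector_derivative_at_within)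
         (simp only: has_real_derivative_iff_has_vector_derivative[symmetric] power_bessel_clifford_deriv)
  qed simp
  then show ?thesis by (simp add: integral_unique sum_subtractf)
qed

text \<open>The surplus of 1/4 over the threshold of \<open>summable_coeff\<close> is halved: 1/8
  secures convergence, 1/8 becomes decay in M.\<close>

lemma voronoi_tail_bound:
  obtains C where "C > 0" "\<And>M x. M > 0 \<Longrightarrow> x \<ge> 0 \<Longrightarrow>
    cmod (\<Sum>m. voronoi_term (m + M) x) \<le> C * x powr (real k / 2 + 1/4) * real M powr (-1/8)"
proof -
  let ?s = "real (Suc k) / 2 + 1/4"
  let ?w = "\<lambda>n. cmod (\<alpha> n) * real (Suc n) powr (- ?s)"
  let ?w' = "\<lambda>n. cmod (\<alpha> n) * real (Suc n) powr (- (real (Suc k) / 2 + 1/8))"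
  obtain C where C: "C > 0" "\<And>n x. x \<ge> 0 \<Longrightarrow> norm (voronoi_term n x) \<le>
    C * x powr (real (Suc k) / 2 - 1/4) * ?w n"
    by (rule norm_voronoi_term_le) (rule that, assumption, blast)
  have sm: "summable ?w'"
    by (rule summable_coeff) (simp add: field_simps)
  define W where "W = (\<Sum>n. ?w' n)"
  have W0: "W \<ge> 0" unfolding W_def by (intro suminf_nonneg sm) auto
  show ?thesis
  proof (rule that[of "C * (W + 1)"])
    show "C * (W + 1) > 0" using C(1) W0 by simp
    fix M :: nat and x :: real assume M: "M > 0" and x: "x \<ge> 0"
    let ?X = "x powr (real k / 2 + 1/4)"
    have exps: "real (Suc k) / 2 - 1/4 = real k / 2 + 1/4" by (simp add: field_simps)
    have term_le: "norm (voronoi_term (m + M) x) \<le> C * ?X * real M powr (-1/8) * ?w' (m + M)" for m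
    proof -
      have "real (Suc (m + M)) powr (- ?s) =
          real (Suc (m + M)) powr (-1/8) * real (Suc (m + M)) powr (- (real (Suc k) / 2 + 1/8))"
        unfolding powr_add[symmetric] by (rule arg_cong2[where f = "(powr)"]) (simp_all add: field_simps)
      moreover have "real (Suc (m + M)) powr (-1/8) \<le> real M powr (-1/8)"
        using M by (intro powr_mono2') auto
      ultimately have "?w (m + M) \<le> real M powr (-1/8) * ?w' (m + M)"
        using mult_right_mono[of "real (Suc (m + M)) powr (-1/8)" "real M powr (-1/8)" "?w' (m + M)"]
        by (simp only: mult_ac) simp
      then have "C * ?X * ?w (m + M) \<le> C * ?X * (real M powr (-1/8) * ?w' (m + M))"
        using C(1) by (intro mult_left_mono) auto
      then show ?thesis
        using C(2)[OF x, of "m + M"] unfolding exps by (simp only: mult.assoc)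
    qed
    have sm': "summable (\<lambda>m. ?w' (m + M))" by (rule summable_ignore_initial_segment[OF sm])
    have "cmod (\<Sum>m. voronoi_term (m + M) x) \<le> (\<Sum>m. C * ?X * real M powr (-1/8) * ?w' (m + M))"
      by (rule norm_suminf_le[OF term_le summable_mult[OF sm']])
    also have "\<dots> = C * ?X * real M powr (-1/8) * (\<Sum>m. ?w' (m + M))"
      by (rule suminf_mult[OF sm'])
    also have "\<dots> \<le> C * ?X * real M powr (-1/8) * (W + 1)"
    proof (intro mult_left_mono)
      have "W = (\<Sum>m. ?w' (m + M)) + (\<Sum>m<M. ?w' m)"
        unfolding W_def by (rule suminf_split_initial_segment[OF sm])
      moreover have "(\<Sum>m<M. ?w' m) \<ge> 0" by (intro sum_nonneg) auto
      ultimately show "(\<Sum>m. ?w' (m + M)) \<le> W + 1" by linarith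
    qed (use C(1) in auto)
    finally show "cmod (\<Sum>m. voronoi_term (m + M) x) \<le> C * (W + 1) * ?X * real M powr (-1/8)"
      by (simp only: mult_ac)
  qed
qed

lemma summable_voronoi_term:
  assumes "x \<ge> 0"
  shows "summable (\<lambda>n. voronoi_term n x)"
proof -
  obtain C where C: "C > 0" "\<And>n x. x \<ge> 0 \<Longrightarrow> norm (voronoi_term n x) \<le>
    C * x powr (real (Suc k) / 2 - 1/4) * (cmod (\<alpha> n) * real (Suc n) powr (- (real (Suc k) / 2 + 1/4)))"
    by (rule norm_voronoi_term_le) (rule that, assumption, blast)
  show ?thesis
    by (rule summable_comparison_test'[OF summable_mult[OF summable_voronoi_weight]])
       (rule C(2)[OF assms])
qed

lemma cmod_voronoi_head_sq:
  assumes t: "t > 0"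
  shows "(cmod (voronoi_head M t))\<^sup>2 = t ^ k *
    (cmod (\<Sum>m<M. (\<alpha> m / of_real (sqrt (4 * pi\<^sup>2 * real (Suc m)) ^ k)) *
        of_real (bessel_sqrt k (4 * pi\<^sup>2 * real (Suc m) * t))))\<^sup>2"
proof -
  have "voronoi_head M t = of_real (sqrt t ^ k) *
    (\<Sum>m<M. (\<alpha> m / of_real (sqrt (4 * pi\<^sup>2 * real (Suc m)) ^ k)) *
        of_real (bessel_sqrt k (4 * pi\<^sup>2 * real (Suc m) * t)))"
    unfolding voronoi_head_def sum_distrib_left
  proof (intro sum.cong refl)
    fix m
    define l where "l = 4 * pi\<^sup>2 * real (Suc m)"
    have l: "l > 0" by (simp add: l_def)
    have "t ^ k = sqrt t ^ k * sqrt t ^ k"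
      using t by (simp add: power_mult_distrib[symmetric])
    then have "t ^ k * bessel_clifford k (l * t) =
        sqrt t ^ k * (1 / sqrt l ^ k) * bessel_sqrt k (l * t)"
      using l t by (simp add: bessel_sqrt_def real_sqrt_mult power_mult_distrib)
    then have "complex_of_real (t ^ k * bessel_clifford k (l * t)) =
        of_real (sqrt t ^ k * (1 / sqrt l ^ k) * bessel_sqrt k (l * t))"
      by simp
    then show "\<alpha> m * of_real (t ^ k * bessel_clifford k (4 * pi\<^sup>2 * real (Suc m) * t)) =
        of_real (sqrt t ^ k) * ((\<alpha> m / of_real (sqrt (4 * pi\<^sup>2 * real (Suc m)) ^ k)) *
          of_real (bessel_sqrt k (4 * pi\<^sup>2 * real (Suc m) * t)))"
      unfolding l_def[symmetric] by simp
  qed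
  then show ?thesis
    using t by (simp add: norm_mult power_mult_distrib norm_power power_mult[symmetric] mult.commute[of k]
        power_mult)
qed

text \<open>With \<open>q \<le> 4 * p\<close> every t in the range is comparable to p. The first
  summand collects the diagonal and the tail of the series, the second the off-diagonal
  terms.\<close>

theorem mean_square_bound:
  obtains C where "C > 0" "\<And>p q. 1 \<le> p \<Longrightarrow> p \<le> q \<Longrightarrow> q \<le> 4 * p \<Longrightarrow>
    (\<Sum>n=p..<q. (cmod (\<Sum>m<n. \<alpha> m))\<^sup>2) \<le>
    C * (real p powr (real k - 1/2) * (real q - real p) + real p powr (real k + 1/6))"
proof -
  obtain C1 where C1: "C1 > 0" "\<And>M x. M > 0 \<Longrightarrow> x \<ge> 0 \<Longrightarrow>
    cmod (\<Sum>m. voronoi_term (m + M) x) \<le> C1 * x powr (real k / 2 + 1/4) * real M powr (-1/8)"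
    by (rule voronoi_tail_bound) (rule that, assumption, blast)
  obtain C2 where C2: "C2 > 0" "\<And>u N a b. 1 \<le> a \<Longrightarrow> a \<le> b \<Longrightarrow>
    integral {a..b} (\<lambda>t. (cmod (\<Sum>n<N. u n * of_real (bessel_sqrt k (4 * pi\<^sup>2 * real (Suc n) * t))))\<^sup>2) \<le>
    C2 * ((b - a) * a powr (-1/2) * (\<Sum>n<N. (cmod (u n))\<^sup>2 * real (Suc n) powr (-1/2))
       + (\<Sum>d<N. 1 / real (Suc d)) * (\<Sum>n<N. (cmod (u n))\<^sup>2))"
    by (rule bessel_sqrt_mean_square[of k]) (rule that, assumption, blast)
  define c :: complex where "c = (2 * of_real pi / \<i>) ^ k"
  define u where "u m = \<alpha> m / of_real (sqrt (4 * pi\<^sup>2 * real (Suc m)) ^ k)" for m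
  define A where "A = (\<Sum>n. (cmod (\<alpha> n))\<^sup>2 * real (Suc n) powr (- (real k + 1/2)))"
  \<comment> \<open>\<open>K1\<close> and \<open>K2\<close> are Dirichlet series at distance 1/48
    inside their regions of convergence; passing to the sums up to M = p^4 costs p^(1/12) for
    each.\<close>
  define K1 where "K1 = (\<Sum>n. 1 * real (Suc n) powr (- (1 + 1/48)))"
  define K2 where "K2 = (\<Sum>n. (cmod (\<alpha> n))\<^sup>2 * real (Suc n) powr (- (real k + 1/48)))"
  have smA: "summable (\<lambda>n. (cmod (\<alpha> n))\<^sup>2 * real (Suc n) powr (- (real k + 1/2)))"
    by (rule summable_coeff_sq) simp
  have smK2: "summable (\<lambda>n. (cmod (\<alpha> n))\<^sup>2 * real (Suc n) powr (- (real k + 1/48)))"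
    by (rule summable_coeff_sq) simp
  have smK1: "summable (\<lambda>n. 1 * real (Suc n) powr (- (1 + 1/48)))"
    by (subst summable_Suc_iff[where f = "\<lambda>n. 1 * real n powr (- (1 + 1/48))"])
       (simp add: summable_real_powr_iff)
  have nn: "A \<ge> 0" "K1 \<ge> 0" "K2 \<ge> 0"
    unfolding A_def K1_def K2_def by (intro suminf_nonneg smA smK1 smK2; simp)+
  have u2: "(cmod (u m))\<^sup>2 \<le> (cmod (\<alpha> m))\<^sup>2 * real (Suc m) powr (- real k)" for m
  proof -
    let ?l = "4 * pi\<^sup>2 * real (Suc m)"
    from mult_right_mono[OF four_pi_square_ge_one, of "real (Suc m)"] have l: "real (Suc m) \<le> ?l" by simp
    have "(sqrt ?l ^ k)\<^sup>2 = ?l ^ k"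
      by (simp add: power_mult[symmetric] mult.commute[of k] power_mult del: of_nat_Suc)
    then have "(cmod (u m))\<^sup>2 = (cmod (\<alpha> m))\<^sup>2 / ?l ^ k"
      by (simp add: u_def norm_divide norm_power power_divide del: of_nat_Suc)
    also have "\<dots> \<le> (cmod (\<alpha> m))\<^sup>2 / real (Suc m) ^ k"
      using l by (intro divide_left_mono power_mono) auto
    also have "\<dots> = (cmod (\<alpha> m))\<^sup>2 * real (Suc m) powr (- real k)"
      by (simp add: powr_minus_divide powr_realpow del: of_nat_Suc)
    finally show ?thesis .
  qed
  \<comment> \<open>In \<open>D\<close>, 4^k comes from t^k \<le> (4p)^k. In \<open>E\<close>, the
    factor 4 is the square of the two tails at n and n + 1, and the power of 4 is the square of
    4^(k/2 + 1/4).\<close>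
  define D where "D = 4 ^ k * (C2 * (A + K1 * K2))"
  define E where "E = 4 * C1\<^sup>2 * 4 powr (real k + 1/2)"
  have D0: "D \<ge> 0" unfolding D_def using nn C2(1) by auto
  have E0: "E \<ge> 0" unfolding E_def by auto
  show ?thesis
  proof (rule that[of "2 * (cmod c)\<^sup>2 * (D + E) + 1"])
    show "2 * (cmod c)\<^sup>2 * (D + E) + 1 > 0" using D0 E0 by (intro add_nonneg_pos) auto
    fix p q :: nat assume pq: "1 \<le> p" "p \<le> q" "q \<le> 4 * p"
    define M where "M = p ^ 4"
    have M: "M > 0" using pq by (simp add: M_def)
    have Mpow: "real M powr s = real p powr (4 * s)" for s
    proof -
      have "real M = real p powr 4" using pq by (simp add: M_def powr_numeral)
      then show ?thesis by (simp only: powr_powr)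
    qed
    define r where "r = real p powr (real k - 1/2)"
    define r' where "r' = real p powr (real k + 1/6)"
    define h where "h n = integral {real n..real n + 1} (voronoi_head M)" for n
    have tail: "cmod (\<Sum>m. voronoi_term (m + M) x) \<le> C1 * (4 * real p) powr (real k / 2 + 1/4) * real p powr (-1/2)"
      if "0 \<le> x" "x \<le> 4 * real p" for x
    proof -
      have "cmod (\<Sum>m. voronoi_term (m + M) x) \<le> C1 * x powr (real k / 2 + 1/4) * real M powr (-1/8)"
        by (rule C1(2)[OF M that(1)])
      also have "real M powr (-1/8) = real p powr (-1/2)"
        unfolding Mpow by simp
      also have "C1 * x powr (real k / 2 + 1/4) * real p powr (-1/2) \<le>
          C1 * (4 * real p) powr (real k / 2 + 1/4) * real p powr (-1/2)"
        using that C1(1) by (intro mult_right_mono mult_left_mono powr_mono2) auto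
      finally show ?thesis .
    qed
    have pointwise: "(cmod (\<Sum>m<n. \<alpha> m))\<^sup>2 \<le> 2 * (cmod c)\<^sup>2 * ((cmod (h n))\<^sup>2 + E * r)"
      if n: "p \<le> n" "n < q" for n
    proof -
      define T where "T = (\<Sum>m. voronoi_term (m + M) (real n + 1)) - (\<Sum>m. voronoi_term (m + M) (real n))"
      have split: "(\<Sum>m. voronoi_term m x) = (\<Sum>m. voronoi_term (m + M) x) + (\<Sum>m<M. voronoi_term m x)"
        if "x \<ge> 0" for x
        by (rule suminf_split_initial_segment[OF summable_voronoi_term[OF that]])
      have "(\<Sum>m<n. \<alpha> m) = c * (\<Sum>m. voronoi_term m (real n + 1)) - c * (\<Sum>m. voronoi_term m (real n))"
        unfolding partial_sum_eq_riesz_diff c_def by (subst (1 2) voronoi_riesz) auto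
      also have "\<dots> = c * (h n + T)"
        unfolding T_def h_def voronoi_head_integral[symmetric]
        by (subst (1 2) split) (auto simp: sum_subtractf algebra_simps)
      finally have S: "(\<Sum>m<n. \<alpha> m) = c * (h n + T)" .
      define b where "b = C1 * (4 * real p) powr (real k / 2 + 1/4) * real p powr (-1/2)"
      have "cmod T \<le> b + b"
        unfolding T_def b_def using n pq
        by (intro order_trans[OF norm_triangle_ineq4] add_mono tail) auto
      then have "(cmod T)\<^sup>2 \<le> (b + b)\<^sup>2" by (intro power_mono) auto
      also have "\<dots> = E * r"
      proof -
        have "((4 * real p) powr (real k / 2 + 1/4))\<^sup>2 = (4 * real p) powr (real k + 1/2)"
          unfolding power2_eq_square powr_add[symmetric] by simp
        also have "\<dots> = 4 powr (real k + 1/2) * real p powr (real k + 1/2)"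
          by (rule powr_mult)
        finally have e1: "((4 * real p) powr (real k / 2 + 1/4))\<^sup>2 =
            4 powr (real k + 1/2) * real p powr (real k + 1/2)" .
        have e2: "real p powr (real k + 1/2) * (real p powr (-1/2))\<^sup>2 = r"
          unfolding power2_eq_square powr_add[symmetric] r_def by simp
        have "(b + b)\<^sup>2 = 4 * C1\<^sup>2 * ((4 * real p) powr (real k / 2 + 1/4))\<^sup>2 * (real p powr (-1/2))\<^sup>2"
          unfolding b_def by (simp add: power2_eq_square algebra_simps)
        also have "\<dots> = E * r"
          unfolding e1 E_def e2[symmetric] by (simp only: mult_ac)
        finally show ?thesis .
      qed
      finally have T2: "(cmod T)\<^sup>2 \<le> E * r" .
      have "(cmod (h n + T))\<^sup>2 \<le> (cmod (h n) + cmod T)\<^sup>2"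
        by (intro power_mono norm_triangle_ineq) auto
      also have "\<dots> \<le> 2 * ((cmod (h n))\<^sup>2 + (cmod T)\<^sup>2)"
        using sum_squares_bound[of "cmod (h n)" "cmod T"] by (simp add: power2_sum)
      also have "\<dots> \<le> 2 * ((cmod (h n))\<^sup>2 + E * r)" using T2 by simp
      finally have "(cmod c)\<^sup>2 * (cmod (h n + T))\<^sup>2 \<le> (cmod c)\<^sup>2 * (2 * ((cmod (h n))\<^sup>2 + E * r))"
        by (intro mult_left_mono) auto
      then show ?thesis
        unfolding S norm_mult power_mult_distrib by (simp only: mult.assoc mult.left_commute[of 2])
    qed
    have head: "(\<Sum>n=p..<q. (cmod (h n))\<^sup>2) \<le> D * (r * (real q - real p) + r')"
    proof -
      have "(cmod (h n))\<^sup>2 \<le> integral {real n..real n + 1} (\<lambda>t. (cmod (voronoi_head M t))\<^sup>2)" for n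
      proof -
        have "cmod (h n) \<le> integral {real n..real n + 1} (\<lambda>t. cmod (voronoi_head M t))"
          unfolding h_def
          by (intro integral_norm_bound_integral integrable_continuous_real continuous_intros) auto
        then have "(cmod (h n))\<^sup>2 \<le> (integral {real n..real n + 1} (\<lambda>t. cmod (voronoi_head M t)))\<^sup>2"
          by (intro power_mono) auto
        also have "\<dots> \<le> integral {real n..real n + 1} (\<lambda>t. (cmod (voronoi_head M t))\<^sup>2)"
          by (intro square_integral_le continuous_intros)
        finally show ?thesis .
      qed
      then have "(\<Sum>n=p..<q. (cmod (h n))\<^sup>2) \<le>
          (\<Sum>n=p..<q. integral {real n..real n + 1} (\<lambda>t. (cmod (voronoi_head M t))\<^sup>2))"
        by (intro sum_mono)
      also have "\<dots> = integral {real p..real q} (\<lambda>t. (cmod (voronoi_head M t))\<^sup>2)"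
        by (intro sum_integral_unit_intervals pq continuous_intros)
      also have "\<dots> \<le> integral {real p..real q} (\<lambda>t. (4 * real p) ^ k *
          (cmod (\<Sum>n<M. u n * of_real (bessel_sqrt k (4 * pi\<^sup>2 * real (Suc n) * t))))\<^sup>2)"
      proof (rule integral_le)
        fix t assume t: "t \<in> {real p..real q}"
        then have t0: "t > 0" "t \<le> 4 * real p" using pq by auto
        show "(cmod (voronoi_head M t))\<^sup>2 \<le> (4 * real p) ^ k *
          (cmod (\<Sum>n<M. u n * of_real (bessel_sqrt k (4 * pi\<^sup>2 * real (Suc n) * t))))\<^sup>2"
          unfolding cmod_voronoi_head_sq[OF t0(1)] u_def[symmetric]
          using t0 by (intro mult_right_mono power_mono) auto
      qed (intro integrable_continuous_real continuous_intros)+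
      also have "\<dots> = (4 * real p) ^ k * integral {real p..real q} (\<lambda>t.
          (cmod (\<Sum>n<M. u n * of_real (bessel_sqrt k (4 * pi\<^sup>2 * real (Suc n) * t))))\<^sup>2)"
        by (rule integral_mult_right)
      also have "\<dots> \<le> (4 * real p) ^ k * (C2 * ((real q - real p) * real p powr (-1/2) *
            (\<Sum>n<M. (cmod (u n))\<^sup>2 * real (Suc n) powr (-1/2))
          + (\<Sum>d<M. 1 / real (Suc d)) * (\<Sum>n<M. (cmod (u n))\<^sup>2)))"
        using pq by (intro mult_left_mono C2(2)) auto
      also have "\<dots> \<le> (4 * real p) ^ k * (C2 * ((real q - real p) * real p powr (-1/2) * A
          + (real p powr (1/12) * K1) * (real p powr (1/12) * K2)))"
      proof (intro mult_left_mono add_mono mult_mono)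
        have "(\<Sum>n<M. (cmod (u n))\<^sup>2 * real (Suc n) powr (-1/2)) \<le>
            (\<Sum>n<M. (cmod (\<alpha> n))\<^sup>2 * real (Suc n) powr (- (real k + 1/2)))"
        proof (intro sum_mono)
          fix n
          have "(cmod (u n))\<^sup>2 * real (Suc n) powr (-1/2) \<le>
              (cmod (\<alpha> n))\<^sup>2 * real (Suc n) powr (- real k) * real (Suc n) powr (-1/2)"
            by (intro mult_right_mono u2) auto
          also have "\<dots> = (cmod (\<alpha> n))\<^sup>2 * real (Suc n) powr (- (real k + 1/2))"
            unfolding mult.assoc powr_add[symmetric] by simp
          finally show "(cmod (u n))\<^sup>2 * real (Suc n) powr (-1/2) \<le>
              (cmod (\<alpha> n))\<^sup>2 * real (Suc n) powr (- (real k + 1/2))" .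
        qed
        also have "\<dots> \<le> A"
          unfolding A_def by (intro sum_le_suminf smA) auto
        finally show "(\<Sum>n<M. (cmod (u n))\<^sup>2 * real (Suc n) powr (-1/2)) \<le> A" .
        have "(\<Sum>d<M. 1 / real (Suc d)) = (\<Sum>d<M. 1 * real (Suc d) powr (- 1))"
          by (simp add: powr_minus_divide del: of_nat_Suc)
        also have "\<dots> \<le> real M powr (1/48) * K1"
          unfolding K1_def by (intro weighted_sum_le smK1) auto
        finally show "(\<Sum>d<M. 1 / real (Suc d)) \<le> real p powr (1/12) * K1"
          by (simp add: Mpow)
        have "(\<Sum>n<M. (cmod (u n))\<^sup>2) \<le> (\<Sum>n<M. (cmod (\<alpha> n))\<^sup>2 * real (Suc n) powr (- real k))"
          by (intro sum_mono u2)
        also have "\<dots> \<le> real M powr (1/48) * K2"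
          unfolding K2_def by (intro weighted_sum_le smK2) auto
        finally show "(\<Sum>n<M. (cmod (u n))\<^sup>2) \<le> real p powr (1/12) * K2"
          by (simp add: Mpow)
      qed (use C2(1) nn pq in \<open>auto intro!: sum_nonneg mult_nonneg_nonneg\<close>)
      also have "\<dots> = 4 ^ k * C2 * (A * (r * (real q - real p)) + K1 * K2 * r')"
      proof -
        have pk: "(4 * real p) ^ k = 4 ^ k * real p powr real k"
          using pq by (simp add: power_mult_distrib powr_realpow)
        have r: "r = real p powr real k * real p powr (-1/2)"
          unfolding r_def powr_add[symmetric] by simp
        have r': "r' = real p powr real k * (real p powr (1/12) * real p powr (1/12))"
          unfolding r'_def powr_add[symmetric] by simp
        show ?thesis unfolding pk r r' by (simp add: algebra_simps)
      qed
      also have "\<dots> \<le> 4 ^ k * C2 * ((A + K1 * K2) * (r * (real q - real p) + r'))"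
      proof (intro mult_left_mono)
        have "0 \<le> r * (real q - real p)" "0 \<le> r'" using pq by (auto simp: r_def r'_def)
        then have "0 \<le> A * r'" "0 \<le> K1 * K2 * (r * (real q - real p))" using nn by auto
        then show "A * (r * (real q - real p)) + K1 * K2 * r' \<le> (A + K1 * K2) * (r * (real q - real p) + r')"
          by (simp add: distrib_left distrib_right)
      qed (use C2(1) in auto)
      also have "\<dots> = D * (r * (real q - real p) + r')"
        unfolding D_def by (simp only: mult.assoc)
      finally show ?thesis .
    qed
    have "(\<Sum>n=p..<q. (cmod (\<Sum>m<n. \<alpha> m))\<^sup>2) \<le> (\<Sum>n=p..<q. 2 * (cmod c)\<^sup>2 * ((cmod (h n))\<^sup>2 + E * r))"
      by (intro sum_mono pointwise) auto
    also have "\<dots> = 2 * (cmod c)\<^sup>2 * ((\<Sum>n=p..<q. (cmod (h n))\<^sup>2) + E * (r * (real q - real p)))"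
      using pq by (simp add: sum_distrib_left[symmetric] sum.distrib of_nat_diff algebra_simps)
    also have "\<dots> \<le> 2 * (cmod c)\<^sup>2 * (D * (r * (real q - real p) + r') + E * (r * (real q - real p) + r'))"
      using E0 head by (intro mult_left_mono add_mono) (auto simp: r'_def)
    also have "\<dots> = 2 * (cmod c)\<^sup>2 * (D + E) * (r * (real q - real p) + r')"
      by (simp only: distrib_right mult.assoc)
    also have "\<dots> \<le> (2 * (cmod c)\<^sup>2 * (D + E) + 1) * (r * (real q - real p) + r')"
      using pq by (intro mult_right_mono) (auto simp: r_def r'_def)
    finally show "(\<Sum>n=p..<q. (cmod (\<Sum>m<n. \<alpha> m))\<^sup>2) \<le> (2 * (cmod c)\<^sup>2 * (D + E) + 1) *
      (real p powr (real k - 1/2) * (real q - real p) + real p powr (real k + 1/6))"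
      unfolding r_def r'_def .
  qed
qed

end

section \<open>Specialisation to the short interval around X\<close>

theorem theorem1:
  fixes f :: "complex \<Rightarrow> complex" and a :: "nat \<Rightarrow> complex" and k :: int
  assumes "k \<ge> 2"
    and "cusp_form k f"
    and "\<forall>z\<in>upper_half_plane.
           (\<lambda>n. a (Suc n) * exp (2 * of_real pi * \<i> * of_nat (Suc n) * z)) sums f z"
  shows "(\<lambda>X::real. 1 / (X powr (2/3) * ln X powr (1/6)) *
            (\<Sum>n | 0 < n \<and> \<bar>real n - X\<bar> < X powr (2/3) * ln X powr (1/6).
               (cmod (coeff_partial_sum a n))\<^sup>2))
         \<in> O[at_top](\<lambda>X. X powr (real_of_int k - 1 + 1/2))"
proof -
  define K where "K = nat k"
  have k: "k = int K" "K > 0" using assms(1) by (auto simp: K_def)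
  interpret cusp_expansion f "\<lambda>n. a (Suc n)" K
    by unfold_locales
       (use assms k in \<open>auto simp: cusp_form_def modular_form_def\<close>)
  have S: "coeff_partial_sum a n = (\<Sum>m<n. a (Suc m))" for n
    unfolding coeff_partial_sum_def using sum.atLeast1_atMost_eq[of a n] by simp
  obtain C where C: "C > 0" "\<And>p q. 1 \<le> p \<Longrightarrow> p \<le> q \<Longrightarrow> q \<le> 4 * p \<Longrightarrow>
    (\<Sum>n=p..<q. (cmod (\<Sum>m<n. a (Suc m)))\<^sup>2) \<le>
    C * (real p powr (real K - 1/2) * (real q - real p) + real p powr (real K + 1/6))"
    by (rule mean_square_bound) (rule that, assumption, blast)
  define H where "H X = X powr (2/3) * ln X powr (1/6)" for X :: real
  have "eventually (\<lambda>X. H X \<le> X / 4) at_top"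
    unfolding H_def by real_asymp
  moreover have "eventually (\<lambda>X. X powr (2/3) \<le> H X) at_top"
    unfolding H_def by real_asymp
  ultimately have "eventually (\<lambda>X. norm (1 / H X * (\<Sum>n | 0 < n \<and> \<bar>real n - X\<bar> < H X.
      (cmod (coeff_partial_sum a n))\<^sup>2)) \<le> 6 * C * norm (X powr (real_of_int k - 1 + 1/2))) at_top"
    using eventually_ge_at_top[of "16::real"]
  proof eventually_elim
    case (elim X)
    define p where "p = nat \<lfloor>X - H X\<rfloor>"
    define q where "q = Suc (nat \<lceil>X + H X\<rceil>)"
    have H1: "H X \<ge> 1"
      using elim ge_one_powr_ge_zero[of X "2/3"] by linarith
    have X4: "X - H X \<ge> 12" using elim by linarith
    have p: "real p \<le> X - H X" "X - H X < real p + 1"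
      using X4 unfolding p_def by (auto simp: of_nat_floor)
    have q: "real q \<ge> X + H X + 1" "real q < X + H X + 2"
      using X4 H1 unfolding q_def by (auto, linarith+)
    \<comment> \<open>From H \<le> X/4 follow p > 3X/4 - 1 and q < 5X/4 + 2; for X \<ge> 16 these
      give q \<le> 4p.\<close>
    have pq: "1 \<le> p" "p \<le> q" "q \<le> 4 * p"
      using p q elim H1 by linarith+
    let ?A = "{n. 0 < n \<and> \<bar>real n - X\<bar> < H X}"
    have sub: "?A \<subseteq> {p..<q}"
    proof
      fix n assume "n \<in> ?A"
      then have "real n > X - H X" "real n < X + H X" by auto
      then have "real p < real n" "real n < real q" using p q by linarith+
      then show "n \<in> {p..<q}" by simp
    qed
    have "(\<Sum>n\<in>?A. (cmod (coeff_partial_sum a n))\<^sup>2) \<le> (\<Sum>n=p..<q. (cmod (\<Sum>m<n. a (Suc m)))\<^sup>2)"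
      unfolding S by (intro sum_mono2 sub) auto
    also have "\<dots> \<le> C * (real p powr (real K - 1/2) * (real q - real p) + real p powr (real K + 1/6))"
      by (rule C(2)[OF pq])
    \<comment> \<open>q - p is below 2H + 3, hence at most 5H because H \<ge> 1.\<close>
    also have "\<dots> \<le> C * (X powr (real K - 1/2) * (5 * H X) + X powr (real K + 1/6))"
      using C(1) p q pq H1 k(2) by (intro mult_left_mono add_mono mult_mono powr_mono2) auto
    \<comment> \<open>Here the length of the interval enters: the off-diagonal part is X^(k - 1/2)
      times X^(2/3), and H is at least X^(2/3).\<close>
    also have "X powr (real K + 1/6) = X powr (real K - 1/2) * X powr (2/3)"
      unfolding powr_add[symmetric] by (rule arg_cong2[where f = "(powr)"]) simp_all
    also have "C * (X powr (real K - 1/2) * (5 * H X) + X powr (real K - 1/2) * X powr (2/3)) \<le>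
        C * (X powr (real K - 1/2) * (5 * H X) + X powr (real K - 1/2) * H X)"
      using C(1) elim by (intro mult_left_mono add_left_mono) auto
    also have "\<dots> = 6 * C * X powr (real K - 1/2) * H X"
      by (simp add: algebra_simps)
    finally have "1 / H X * (\<Sum>n\<in>?A. (cmod (coeff_partial_sum a n))\<^sup>2) \<le> 6 * C * X powr (real K - 1/2)"
      using H1 by (simp add: field_simps)
    moreover have "0 \<le> 1 / H X * (\<Sum>n\<in>?A. (cmod (coeff_partial_sum a n))\<^sup>2)"
      using H1 by (intro mult_nonneg_nonneg sum_nonneg) auto
    moreover have "real_of_int k - 1 + 1/2 = real K - 1/2" using k(1) by simp
    ultimately show ?case by simp
  qed
  then show ?thesis unfolding H_def by (rule bigoI)
qed

end
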